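(* Let $G$ be a graph with clique number $\omega$, let $t$ be an integer with $2\le t\le \omega$, and let $\rho_t(G)$ be the $t$-clique spectral radius of $G$. Then $$\left( \rho_{t}(G)\right)^{t}\le t \left( \sum_{v\in V(G)} c_{t}(v) \sqrt[t-1]{\binom{\alpha(v)}{t}\left(\alpha(v)\right)^{-t}} \right)^{t-1}.$$ Equality holds if and only if the graph obtained from $G$ by deleting all edges not contained in $t$-cliques of $G$ is, possibly together with some isolated vertices, a complete $\omega$-partite graph in the case $\omega=t$, or a complete regular $\omega$-partite graph in the case $\omega\ge t+1$.
   Context: All graphs are finite, simple and undirected. A clique of $G$ is a set of vertices whose induced subgraph is complete; a $t$-clique is a clique with exactly $t$ vertices; $C_t(G)$ is the set of all $t$-cliques of $G$. The clique number $\omega=\omega(G)$ is the number of vertices of a largest clique. For a vertex $v$, $\alpha(v)$ is the number of vertices of the largest clique of $G$ containing $v$, and $c_t(v)$ is the number of $t$-cliques of $G$ containing $v$. As usual $\binom{m}{t}=0$ for $0\le m<t$. An edge is contained in a $t$-clique if both its endpoints belong to that $t$-clique. For $V(G)=[n]=\{1,\dots,n\}$ and $2\le t\le\omega(G)$, the $t$-clique tensor $\mathcal{A}(G)=(a_{i_1i_2\cdots i_t})$ is the $t$-order $n$-dimensional tensor with $a_{i_1\cdots i_t}=\frac{1}{(t-1)!}$ if $\{i_1,\dots,i_t\}\in C_t(G)$ and $a_{i_1\cdots i_t}=0$ otherwise. A number $\lambda\in\mathbb{C}$ is an eigenvalue of a $t$-order $n$-dimensional tensor $\mathcal{A}$ if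 there is a nonzero $x\in\mathbb{C}^n$ with $\sum_{i_2,\dots,i_t=1}^n a_{i i_2\cdots i_t}x_{i_2}\cdots x_{i_t}=\lambda x_i^{t-1}$ for all $i\in[n]$. The spectral radius of $\mathcal{A}$ is the maximum modulus of its eigenvalues, and the $t$-clique spectral radius $\rho_t(G)$ is the spectral radius of the $t$-clique tensor of $G$. A complete $\omega$-partite graph has its vertex set partitioned into $\omega$ nonempty classes, two vertices being adjacent exactly when they lie in different classes; it is called a complete regular $\omega$-partite graph if all classes have the same size. "Possibly together with some isolated vertices" means that the graph is the disjoint union of such a graph and a (possibly empty) set of isolated vertices. *)

theory Defs
  imports
    "HOL-Analysis.Analysis"
    "HOL-Library.Disjoint_Sets"
    "Graph_Theory.Graph_Theory"
begin

text \<open>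
  A finite simple undirected graph is a \<open>pair_graph\<close>: finitely many vertices and a symmetric,
  irreflexive arc relation, where the undirected edge $uv$ is the pair of arcs $(u,v)$, $(v,u)$.
\<close>

section \<open>Cliques\<close>

definition clique :: "'a pair_pre_digraph \<Rightarrow> 'a set \<Rightarrow> bool" where
  "clique G K \<longleftrightarrow> K \<subseteq> pverts G \<and> complete_digraph (card K) (with_proj G \<restriction> K)"

definition cliques_of_size :: "'a pair_pre_digraph \<Rightarrow> nat \<Rightarrow> 'a set set" where
  "cliques_of_size G t = {K. clique G K \<and> card K = t}"

definition clique_number :: "'a pair_pre_digraph \<Rightarrow> nat" where
  "clique_number G = Max (card ` {K. clique G K})"

definition vertex_clique_number :: "'a pair_pre_digraph \<Rightarrow> 'a \<Rightarrow> nat" where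
  "vertex_clique_number G v = Max (card ` {K. clique G K \<and> v \<in> K})"

definition vertex_clique_count :: "'a pair_pre_digraph \<Rightarrow> nat \<Rightarrow> 'a \<Rightarrow> nat" where
  "vertex_clique_count G t v = card {K \<in> cliques_of_size G t. v \<in> K}"

section \<open>Tensors and their eigenvalues\<close>

text \<open>
  A tensor of order \<open>t\<close> with finite index set \<open>I\<close> is given by its entries at the lists
  $[i_1, \dots, i_t]$ over \<open>I\<close>; for $I = \{1,\dots,n\}$ this is a \<open>t\<close>-order \<open>n\<close>-dimensional
  tensor.  Only the values of a vector \<open>x\<close> on \<open>I\<close> matter, so being nonzero is required on \<open>I\<close>.
\<close>

definition tensor_eigenvalue ::
    "nat \<Rightarrow> 'a set \<Rightarrow> ('a list \<Rightarrow> complex) \<Rightarrow> complex \<Rightarrow> bool" where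
  "tensor_eigenvalue t I A \<mu> \<longleftrightarrow>
     (\<exists>x :: 'a \<Rightarrow> complex. (\<exists>i\<in>I. x i \<noteq> 0) \<and>
        (\<forall>i\<in>I. (\<Sum>js | set js \<subseteq> I \<and> length js = t - 1. A (i # js) * (\<Prod>j\<leftarrow>js. x j))
                = \<mu> * x i ^ (t - 1)))"

text \<open>
  The maximum is taken with \<open>GREATEST\<close> because \<open>Max\<close> would presuppose that the set of
  eigenvalues is finite.
\<close>

definition tensor_spectral_radius :: "nat \<Rightarrow> 'a set \<Rightarrow> ('a list \<Rightarrow> complex) \<Rightarrow> real" where
  "tensor_spectral_radius t I A =
     (GREATEST r. \<exists>\<mu>. tensor_eigenvalue t I A \<mu> \<and> r = cmod \<mu>)"

definition clique_tensor :: "'a pair_pre_digraph \<Rightarrow> nat \<Rightarrow> 'a list \<Rightarrow> complex" where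
  "clique_tensor G t vs =
     (if length vs = t \<and> set vs \<in> cliques_of_size G t then 1 / fact (t - 1) else 0)"

definition clique_spectral_radius :: "'a pair_pre_digraph \<Rightarrow> nat \<Rightarrow> real" where
  "clique_spectral_radius G t = tensor_spectral_radius t (pverts G) (clique_tensor G t)"

section \<open>The extremal graphs\<close>

definition delete_non_clique_edges :: "'a pair_pre_digraph \<Rightarrow> nat \<Rightarrow> 'a pair_pre_digraph" where
  "delete_non_clique_edges G t =
     \<lparr>pverts = pverts G,
      parcs = {(u, v) \<in> parcs G. \<exists>K \<in> cliques_of_size G t. u \<in> K \<and> v \<in> K}\<rparr>"

definition complete_multipartite_with :: "'a set set \<Rightarrow> 'a pair_pre_digraph \<Rightarrow> bool" where
  "complete_multipartite_with P H \<longleftrightarrow>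
     pair_graph H \<and> partition_on (pverts H) P \<and>
     parcs H = {(u, v) \<in> pverts H \<times> pverts H. \<not> (\<exists>A\<in>P. u \<in> A \<and> v \<in> A)}"

definition complete_multipartite :: "nat \<Rightarrow> 'a pair_pre_digraph \<Rightarrow> bool" where
  "complete_multipartite k H \<longleftrightarrow> (\<exists>P. card P = k \<and> complete_multipartite_with P H)"

definition complete_regular_multipartite :: "nat \<Rightarrow> 'a pair_pre_digraph \<Rightarrow> bool" where
  "complete_regular_multipartite k H \<longleftrightarrow>
     (\<exists>P. card P = k \<and> complete_multipartite_with P H \<and> (\<forall>A\<in>P. \<forall>B\<in>P. card A = card B))"

text \<open>\<open>H\<close> is, possibly together with some isolated vertices, a graph satisfying \<open>Q\<close>.\<close>

definition up_to_isolated_vertices ::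
    "('a pair_pre_digraph \<Rightarrow> bool) \<Rightarrow> 'a pair_pre_digraph \<Rightarrow> bool" where
  "up_to_isolated_vertices Q H \<longleftrightarrow>
     (\<exists>W \<subseteq> pverts H. parcs H \<subseteq> W \<times> W \<and> Q \<lparr>pverts = W, parcs = parcs H\<rparr>)"

end

theory Submission
  imports Defs "HOL-Combinatorics.Multiset_Permutations"
begin

text \<open>
  The spectral radius \<open>\<rho>\<close> of the clique tensor is \<open>t\<close> times the maximum of the clique form, the sum over all
  \<open>t\<close>-cliques \<open>K\<close> of \<open>\<Prod>v\<in>K. x v\<close>, over the nonnegative vectors \<open>x\<close> with \<open>(\<Sum>v. x v ^ t) = 1\<close>
  (\<open>clique_spectral_radius_variational\<close>).  So the form has to be bounded on this sphere, and its maximisers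
  have to be understood.

  Let \<open>\<alpha> v\<close> be the size of the largest clique at \<open>v\<close>, let \<open>f a = (a choose t) / a ^ t\<close>, and give the vertex \<open>v\<close> the weight
  \<open>root (t - 1) (f (\<alpha> v))\<close> and a clique \<open>K\<close> the average \<open>b K\<close> of the weights of its vertices
  (\<open>vertex_weight\<close> and \<open>clique_weight\<close> below).  Double counting shows
  that \<open>\<Sum>K. b K\<close> is \<open>1 / t\<close> times the sum on the right-hand side of the theorem.  With \<open>y v = x v ^ t\<close>, Radon's form of
  Hoelder's inequality gives

  \<open>(\<Sum>K. \<Prod>v\<in>K. x v) ^ t \<le> (\<Sum>K. (\<Prod>v\<in>K. y v) / b K ^ (t - 1)) * (\<Sum>K. b K) ^ (t - 1)\<close>,

  and it remains to see that the first factor is at most \<open>1\<close> when \<open>y\<close> lies on the standard simplex.  This is a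
  Motzkin--Straus inequality in which each clique carries its own coefficient (\<open>localised_Motzkin_Straus\<close>): shifting
  mass between nonadjacent vertices concentrates \<open>y\<close> on a clique \<open>S\<close>, where \<open>b K ^ (t - 1) \<ge> f (card S)\<close>, and there
  it is Maclaurin's inequality for elementary symmetric polynomials.

  If equality holds, \<open>y\<close> is a maximiser in the Motzkin--Straus inequality, and it is positive on all vertices of
  \<open>t\<close>-cliques because Radon's inequality is tight.  A second-order argument at such a maximiser shows that being in no
  common \<open>t\<close>-clique is transitive (\<open>maximiser_cooccurrence\<close>), so the edges of \<open>t\<close>-cliques form a complete multipartite
  graph on these vertices.  Then \<open>\<alpha>\<close> is constantly the clique number \<open>\<omega>\<close>, and the tightness of Radon's inequality
  says that \<open>\<Prod>v\<in>K. x v\<close> is the same for all \<open>K\<close>.  If \<open>\<omega> > t\<close>, exchanging single vertices in cliques shows that \<open>x\<close> is constant, and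
  equality in Maclaurin's inequality for the class sums of \<open>y\<close> forces classes of equal size.  Conversely, spreading
  the same mass evenly over each class makes both inequalities tight.
\<close>

section \<open>Tangent lines of powers and Radon's inequality\<close>

text \<open>
  This is the tangent line of \<open>z \<mapsto> z ^ Suc n\<close> at \<open>a\<close>, evaluated at \<open>b\<close>; by convexity it stays
  below the graph.  Multiplying the case \<open>n\<close> by \<open>b\<close> leaves a defect \<open>Suc n * a ^ n * (a - b)\<^sup>2\<close>,
  which gives the induction and, in the next lemma, the case of equality.
\<close>

lemma weighted_power_mean_ineq:
  fixes a b :: real
  assumes "0 \<le> a" "0 \<le> b"
  shows "real (Suc n) * a ^ n * b \<le> real n * a ^ Suc n + b ^ Suc n"
proof (induction n)
  case 0
  then show ?case by simp
next
  case (Suc n)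
  have "(real (Suc n) * a ^ Suc (Suc n) + b ^ Suc (Suc n)) - real (Suc (Suc n)) * a ^ Suc n * b
      = b * (real n * a ^ Suc n + b ^ Suc n - real (Suc n) * a ^ n * b)
        + real (Suc n) * a ^ n * (a - b)\<^sup>2"
    by (simp add: algebra_simps power2_eq_square)
  moreover have "0 \<le> b * (real n * a ^ Suc n + b ^ Suc n - real (Suc n) * a ^ n * b)"
    using Suc assms by (intro mult_nonneg_nonneg) auto
  moreover have "0 \<le> real (Suc n) * a ^ n * (a - b)\<^sup>2"
    using assms by simp
  ultimately show ?case by linarith
qed

lemma weighted_power_mean_eqD:
  fixes a b :: real
  assumes "0 \<le> a" "0 \<le> b" "0 < n"
    and eq: "real (Suc n) * a ^ n * b = real n * a ^ Suc n + b ^ Suc n"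
  shows "a = b"
proof -
  obtain m where n: "n = Suc m" using \<open>0 < n\<close> by (cases n) auto
  have "0 = b * (real m * a ^ Suc m + b ^ Suc m - real (Suc m) * a ^ m * b)
        + real (Suc m) * a ^ m * (a - b)\<^sup>2"
    using eq unfolding n by (simp add: algebra_simps power2_eq_square)
  moreover have "0 \<le> b * (real m * a ^ Suc m + b ^ Suc m - real (Suc m) * a ^ m * b)"
    using weighted_power_mean_ineq[OF assms(1,2), of m] assms by (intro mult_nonneg_nonneg) auto
  moreover have "0 \<le> real (Suc m) * a ^ m * (a - b)\<^sup>2"
    using assms by simp
  ultimately have "real (Suc m) * a ^ m * (a - b)\<^sup>2 = 0" by linarith
  then have "a = 0 \<or> a = b" by auto
  then show ?thesis using eq n by auto
qed

text \<open>
  This is Hoelder's inequality for the exponents \<open>Suc n\<close> and \<open>Suc n / n\<close>, in the form in which the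
  exponents stay integral.  It is Jensen's inequality for \<open>z \<mapsto> z ^ Suc n\<close> at the points
  \<open>p i / b i\<close> with weights \<open>b i\<close>: the tangent line is taken at the weighted mean of these points, and
  in the case of equality all of them coincide with the mean.
\<close>

lemma Radon_ineq:
  fixes p b :: "'i \<Rightarrow> real"
  assumes "finite I" and p: "\<And>i. i \<in> I \<Longrightarrow> 0 \<le> p i" and b: "\<And>i. i \<in> I \<Longrightarrow> 0 < b i"
  shows "(\<Sum>i\<in>I. p i) ^ Suc n \<le> (\<Sum>i\<in>I. p i ^ Suc n / b i ^ n) * (\<Sum>i\<in>I. b i) ^ n"
    and "0 < n \<Longrightarrow> (\<Sum>i\<in>I. p i) ^ Suc n = (\<Sum>i\<in>I. p i ^ Suc n / b i ^ n) * (\<Sum>i\<in>I. b i) ^ n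
      \<Longrightarrow> i \<in> I \<Longrightarrow> p i = (\<Sum>i\<in>I. p i) / (\<Sum>i\<in>I. b i) * b i"
proof -
  define B where "B = (\<Sum>i\<in>I. b i)"
  define m where "m = (\<Sum>i\<in>I. p i) / B"
  \<comment> \<open>the gap, at the point \<open>p i / b i\<close>, between the power and its tangent line at the mean \<open>m\<close>\<close>
  define d where "d i = b i * (real n * m ^ Suc n + (p i / b i) ^ Suc n
                                - real (Suc n) * m ^ n * (p i / b i))" for i
  have B: "B \<noteq> 0" "B \<ge> 0" if "I \<noteq> {}"
    using that assms(1) b sum_pos[of I b] unfolding B_def by fastforce+
  have m: "0 \<le> m" unfolding m_def B_def by (intro divide_nonneg_nonneg sum_nonneg) (auto simp: p b less_imp_le)
  have d: "0 \<le> d i" if "i \<in> I" for i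
    unfolding d_def using weighted_power_mean_ineq[OF m, of "p i / b i" n] p[OF that] b[OF that]
    by (intro mult_nonneg_nonneg) auto
  have sd: "(\<Sum>i\<in>I. d i) = (\<Sum>i\<in>I. p i ^ Suc n / b i ^ n) - B * m ^ Suc n" if "I \<noteq> {}"
  proof -
    have "d i = real n * m ^ Suc n * b i + p i ^ Suc n / b i ^ n - real (Suc n) * m ^ n * p i" if "i \<in> I" for i
      using b[OF that] unfolding d_def by (simp add: field_simps power_divide)
    then have "(\<Sum>i\<in>I. d i) = real n * m ^ Suc n * B + (\<Sum>i\<in>I. p i ^ Suc n / b i ^ n)
        - real (Suc n) * m ^ n * (\<Sum>i\<in>I. p i)"
      by (simp add: sum.distrib sum_subtractf sum_distrib_left B_def)
    also have "(\<Sum>i\<in>I. p i) = m * B" using B[OF that] by (simp add: m_def)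
    finally show ?thesis by (simp add: algebra_simps)
  qed
  have lhs: "(\<Sum>i\<in>I. p i) ^ Suc n = (B * m ^ Suc n) * B ^ n" if "I \<noteq> {}"
  proof -
    have "(\<Sum>i\<in>I. p i) = m * B" using B[OF that] by (simp add: m_def)
    then show ?thesis by (simp add: power_mult_distrib)
  qed
  show "(\<Sum>i\<in>I. p i) ^ Suc n \<le> (\<Sum>i\<in>I. p i ^ Suc n / b i ^ n) * (\<Sum>i\<in>I. b i) ^ n"
  proof (cases "I = {}")
    case False
    have "0 \<le> (\<Sum>i\<in>I. d i)" using d by (rule sum_nonneg)
    then show ?thesis
      unfolding lhs[OF False] B_def[symmetric] sd[OF False]
      using B[OF False] by (intro mult_right_mono) auto
  qed simp
  show "p i = (\<Sum>i\<in>I. p i) / (\<Sum>i\<in>I. b i) * b i"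
    if "0 < n" and eq: "(\<Sum>i\<in>I. p i) ^ Suc n = (\<Sum>i\<in>I. p i ^ Suc n / b i ^ n) * (\<Sum>i\<in>I. b i) ^ n"
      and i: "i \<in> I"
  proof -
    have ne: "I \<noteq> {}" using i by auto
    have "(B * m ^ Suc n) * B ^ n = (\<Sum>i\<in>I. p i ^ Suc n / b i ^ n) * B ^ n"
      using eq unfolding lhs[OF ne] by (simp add: B_def)
    then have "(\<Sum>i\<in>I. d i) = 0" using sd[OF ne] B[OF ne] by auto
    then have "d i = 0" using sum_nonneg_eq_0_iff[OF \<open>finite I\<close> d] i by auto
    then have "real (Suc n) * m ^ n * (p i / b i) = real n * m ^ Suc n + (p i / b i) ^ Suc n"
      using b[OF i] unfolding d_def by auto
    then have "m = p i / b i"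
      using weighted_power_mean_eqD[OF m _ \<open>0 < n\<close>, of "p i / b i"] p[OF i] b[OF i] by auto
    then show ?thesis using b[OF i] unfolding m_def B_def by (simp add: field_simps)
  qed
qed

section \<open>Maclaurin's inequality\<close>

definition elem_sym :: "nat \<Rightarrow> 'a set \<Rightarrow> ('a \<Rightarrow> real) \<Rightarrow> real" where
  "elem_sym t S y = (\<Sum>K | K \<subseteq> S \<and> card K = t. \<Prod>v\<in>K. y v)"

lemma elem_sym_0: "finite S \<Longrightarrow> elem_sym 0 S y = 1"
proof -
  assume "finite S"
  then have "{K. K \<subseteq> S \<and> card K = 0} = {{}}" by (auto dest: finite_subset)
  then show ?thesis by (simp add: elem_sym_def)
qed

lemma elem_sym_insert:
  assumes "finite S" "v \<notin> S"
  shows "elem_sym (Suc t) (insert v S) y = elem_sym (Suc t) S y + y v * elem_sym t S y"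
proof -
  have split: "{K. K \<subseteq> insert v S \<and> card K = Suc t}
      = {K. K \<subseteq> S \<and> card K = Suc t} \<union> insert v ` {K. K \<subseteq> S \<and> card K = t}" (is "?L = ?A \<union> ?B")
  proof (intro equalityI subsetI)
    fix K assume K: "K \<in> ?L"
    then have "finite K" using assms by (auto dest: finite_subset)
    show "K \<in> ?A \<union> ?B"
    proof (cases "v \<in> K")
      case True
      then have "K = insert v (K - {v})" "K - {v} \<subseteq> S" "card (K - {v}) = t"
        using K \<open>finite K\<close> by (auto simp: card_Diff_singleton)
      then show ?thesis by blast
    qed (use K in auto)
  next
    fix K assume "K \<in> ?A \<union> ?B"
    then show "K \<in> ?L"
    proof
      assume "K \<in> ?B"
      then obtain K' where K': "K = insert v K'" "K' \<subseteq> S" "card K' = t" by auto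
      then have "finite K'" "v \<notin> K'" using assms finite_subset by auto
      then show ?thesis using K' by auto
    qed auto
  qed
  have inj: "inj_on (insert v) {K. K \<subseteq> S \<and> card K = t}"
    using assms by (intro inj_onI) (auto dest: insert_ident[THEN iffD1, rotated 2])
  have "elem_sym (Suc t) (insert v S) y = elem_sym (Suc t) S y + (\<Sum>K\<in>?B. \<Prod>v\<in>K. y v)"
    unfolding elem_sym_def split using assms by (intro sum.union_disjoint) auto
  also have "(\<Sum>K\<in>?B. \<Prod>v\<in>K. y v) = (\<Sum>K | K \<subseteq> S \<and> card K = t. \<Prod>v\<in>insert v K. y v)"
    by (simp add: sum.reindex[OF inj])
  also have "\<dots> = (\<Sum>K | K \<subseteq> S \<and> card K = t. y v * (\<Prod>v\<in>K. y v))"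
    using assms by (intro sum.cong refl prod.insert) (auto dest: finite_subset)
  finally show ?thesis by (simp add: elem_sym_def sum_distrib_left)
qed

text \<open>
  One variable \<open>z\<close> joins \<open>m\<close> variables with mean \<open>u\<close>, and \<open>b\<close> is the new mean.  After the binomial
  coefficients are reduced to \<open>m choose n\<close>, the difference of the two sides is a multiple of the
  gap in \<open>weighted_power_mean_ineq\<close> at \<open>u\<close> and \<open>b\<close>.
\<close>

lemma Maclaurin_step:
  fixes u z :: real and m n :: nat
  defines "b \<equiv> (real m * u + z) / real (Suc m)"
  assumes "0 \<le> u" "0 \<le> z"
  shows "real (m choose Suc n) * u ^ Suc n + real (m choose n) * z * u ^ n
      \<le> real (Suc m choose Suc n) * b ^ Suc n"
    and "0 < n \<Longrightarrow> n \<le> m \<Longrightarrow> real (m choose Suc n) * u ^ Suc n + real (m choose n) * z * u ^ n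
      = real (Suc m choose Suc n) * b ^ Suc n \<Longrightarrow> z = b"
proof -
  have b: "0 \<le> b" unfolding b_def using assms by simp
  have z: "z = real (Suc m) * b - real m * u" unfolding b_def by simp
  have c1: "real (Suc n) * real (Suc m choose Suc n) = real (Suc m) * real (m choose n)"
    by (metis Suc_times_binomial_eq mult.commute of_nat_mult)
  have c2: "real (Suc n) * real (m choose Suc n) = (real m - real n) * real (m choose n)"
  proof -
    have "real (Suc n) * real (m choose Suc n) = real (Suc n) * real (Suc m choose Suc n) - real (Suc n) * real (m choose n)"
      by (simp add: algebra_simps)
    then show ?thesis unfolding c1 by (simp add: algebra_simps)
  qed
  have key: "real (Suc n) * (real (Suc m choose Suc n) * b ^ Suc n
        - (real (m choose Suc n) * u ^ Suc n + real (m choose n) * z * u ^ n))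
      = real (Suc m) * real (m choose n) * (real n * u ^ Suc n + b ^ Suc n - real (Suc n) * u ^ n * b)"
  proof -
    have "real (Suc n) * (real (Suc m choose Suc n) * b ^ Suc n
        - (real (m choose Suc n) * u ^ Suc n + real (m choose n) * z * u ^ n))
       = (real (Suc n) * real (Suc m choose Suc n)) * b ^ Suc n
        - (real (Suc n) * real (m choose Suc n)) * u ^ Suc n - real (Suc n) * real (m choose n) * z * u ^ n"
      by (simp only: algebra_simps)
    then show ?thesis unfolding c1 c2 z by (simp add: algebra_simps)
  qed
  have "0 \<le> real (Suc n) * (real (Suc m choose Suc n) * b ^ Suc n
        - (real (m choose Suc n) * u ^ Suc n + real (m choose n) * z * u ^ n))"
    unfolding key using weighted_power_mean_ineq[OF \<open>0 \<le> u\<close> b, of n] by (intro mult_nonneg_nonneg) auto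
  then show "real (m choose Suc n) * u ^ Suc n + real (m choose n) * z * u ^ n
      \<le> real (Suc m choose Suc n) * b ^ Suc n"
    by (simp add: zero_le_mult_iff del: binomial_Suc_Suc power_Suc)
  assume "0 < n" "n \<le> m" and eq: "real (m choose Suc n) * u ^ Suc n + real (m choose n) * z * u ^ n
      = real (Suc m choose Suc n) * b ^ Suc n"
  then have "real (Suc m) * real (m choose n) * (real n * u ^ Suc n + b ^ Suc n - real (Suc n) * u ^ n * b) = 0"
    using key by (simp del: binomial_Suc_Suc power_Suc)
  then have "real (Suc n) * u ^ n * b = real n * u ^ Suc n + b ^ Suc n"
    using \<open>n \<le> m\<close> by (auto simp del: power_Suc)
  then have "u = b" by (rule weighted_power_mean_eqD[OF \<open>0 \<le> u\<close> b \<open>0 < n\<close>])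
  then show "z = b" using z by (simp add: algebra_simps)
qed

theorem Maclaurin_ineq:
  fixes y :: "'a \<Rightarrow> real"
  assumes "finite S" "\<And>v. v \<in> S \<Longrightarrow> 0 \<le> y v"
  shows "elem_sym t S y \<le> real (card S choose t) * ((\<Sum>v\<in>S. y v) / real (card S)) ^ t"
  using assms
proof (induction S arbitrary: t rule: finite_induct)
  case empty
  have "{K::'a set. K = {} \<and> card K = t} = (if t = 0 then {{}} else {})" by auto
  then show ?case by (simp add: elem_sym_def)
next
  case (insert v S)
  show ?case
  proof (cases t)
    case 0
    then show ?thesis using insert by (simp add: elem_sym_0)
  next
    case (Suc n)
    define u where "u = (\<Sum>v\<in>S. y v) / real (card S)"
    have u: "0 \<le> u" unfolding u_def using insert by (auto intro!: divide_nonneg_nonneg sum_nonneg)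
    have tot: "(\<Sum>v\<in>insert v S. y v) = real (card S) * u + y v"
      using insert by (auto simp: u_def)
    have "elem_sym t (insert v S) y = elem_sym (Suc n) S y + y v * elem_sym n S y"
      unfolding Suc using insert by (intro elem_sym_insert)
    also have "\<dots> \<le> real (card S choose Suc n) * u ^ Suc n + y v * (real (card S choose n) * u ^ n)"
      using insert.IH[of "Suc n"] insert.IH[of n] insert.prems unfolding u_def
      by (intro add_mono mult_left_mono) (auto simp del: power_Suc)
    also have "\<dots> = real (card S choose Suc n) * u ^ Suc n + real (card S choose n) * y v * u ^ n"
      by (simp add: algebra_simps)
    also have "\<dots> \<le> real (Suc (card S) choose Suc n) * ((real (card S) * u + y v) / real (Suc (card S))) ^ Suc n"
      using u insert by (intro Maclaurin_step) auto
    finally have "elem_sym t (insert v S) y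
        \<le> real (Suc (card S) choose t) * ((\<Sum>v\<in>insert v S. y v) / real (Suc (card S))) ^ t"
      unfolding tot Suc .
    moreover have "card (insert v S) = Suc (card S)" using insert.hyps by simp
    ultimately show ?thesis by (simp only:)
  qed
qed

text \<open>
  Any element \<open>v\<close> may be the one that is added last in the induction for \<open>Maclaurin_ineq\<close>, so equality
  forces each \<open>y v\<close> to be the mean.  For \<open>t = 1\<close> equality always holds; for \<open>t\<close> above the number of
  variables both sides vanish.
\<close>

lemma Maclaurin_eqD:
  fixes y :: "'a \<Rightarrow> real"
  assumes "finite S" "\<And>v. v \<in> S \<Longrightarrow> 0 \<le> y v" "2 \<le> t" "t \<le> card S"
    and eq: "elem_sym t S y = real (card S choose t) * ((\<Sum>v\<in>S. y v) / real (card S)) ^ t"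
    and "v \<in> S"
  shows "y v = (\<Sum>v\<in>S. y v) / real (card S)"
proof -
  obtain n where t: "t = Suc n" "0 < n" using \<open>2 \<le> t\<close> by (cases t) auto
  define R where "R = S - {v}"
  have R: "S = insert v R" "v \<notin> R" "finite R" "card S = Suc (card R)"
    unfolding R_def using assms by (auto simp: card_gt_0_iff)
  define u where "u = (\<Sum>v\<in>R. y v) / real (card R)"
  have u: "0 \<le> u" unfolding u_def using assms R by (auto intro!: divide_nonneg_nonneg sum_nonneg)
  have mean: "(\<Sum>v\<in>S. y v) / real (card S) = (real (card R) * u + y v) / real (Suc (card R))"
    using R by (auto simp: u_def)
  have "elem_sym t S y = elem_sym (Suc n) R y + y v * elem_sym n R y"
    unfolding t R(1) using R by (intro elem_sym_insert)
  also have "\<dots> \<le> real (card R choose Suc n) * u ^ Suc n + y v * (real (card R choose n) * u ^ n)"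
    using assms R unfolding u_def by (intro add_mono mult_left_mono Maclaurin_ineq) auto
  also have "\<dots> = real (card R choose Suc n) * u ^ Suc n + real (card R choose n) * y v * u ^ n"
    by (simp add: algebra_simps)
  finally have "real (card R choose Suc n) * u ^ Suc n + real (card R choose n) * y v * u ^ n
      = real (Suc (card R) choose Suc n) * ((real (card R) * u + y v) / real (Suc (card R))) ^ Suc n"
    using Maclaurin_step(1)[OF u, of "y v" "card R" n] eq assms(2)[OF \<open>v \<in> S\<close>]
    unfolding mean unfolding t R(4) by linarith
  then show ?thesis
    unfolding mean using u assms t R by (intro Maclaurin_step(2)[where n = n]) auto
qed

text \<open>
  The largest value on the standard simplex of the form that sums the products over the \<open>t\<close>-cliques of a
  complete graph with \<open>a\<close> vertices; it is attained at the uniform vector.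
\<close>

definition clique_density :: "nat \<Rightarrow> nat \<Rightarrow> real" where
  "clique_density t a = real (a choose t) / real a ^ t"

text \<open>
  The uniform vector on \<open>a\<close> of \<open>b\<close> variables is one of the competitors in Maclaurin's inequality for
  \<open>b\<close> variables.
\<close>

lemma clique_density_mono:
  assumes "a \<le> b"
  shows "clique_density t a \<le> clique_density t b"
proof (cases "t \<le> a \<and> 0 < a")
  case True
  define y :: "nat \<Rightarrow> real" where "y i = of_bool (i < a)" for i
  have "real (a choose t) = (\<Sum>K | K \<subseteq> {..<a} \<and> card K = t. 1)"
    by (simp add: n_subsets)
  also have "\<dots> = (\<Sum>K | K \<subseteq> {..<a} \<and> card K = t. \<Prod>v\<in>K. y v)"
    by (intro sum.cong refl prod.neutral[symmetric]) (auto simp: y_def)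
  also have "\<dots> \<le> elem_sym t {..<b} y"
    unfolding elem_sym_def using assms
    by (intro sum_mono2) (auto intro!: prod_nonneg simp: y_def finite_subset[of _ "Pow {..<b}"])
  also have "\<dots> \<le> real (card {..<b} choose t) * ((\<Sum>v<b. y v) / real (card {..<b})) ^ t"
    by (intro Maclaurin_ineq) (auto simp: y_def)
  also have "(\<Sum>v<b. y v) = real a"
  proof -
    have "(\<Sum>v<b. y v) = real (card {v \<in> {..<b}. v < a})"
      unfolding y_def by (simp add: sum_of_bool_eq Collect_conj_eq lessThan_def)
    also have "{v \<in> {..<b}. v < a} = {..<a}" using assms by auto
    finally show ?thesis by simp
  qed
  finally show ?thesis using True assms by (simp add: clique_density_def field_simps)
next
  case False
  then have "t = 0 \<or> a < t" by auto
  then show ?thesis by (auto simp: clique_density_def binomial_eq_0)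
qed

lemma clique_density_nonneg: "0 \<le> clique_density t a"
  by (simp add: clique_density_def)

lemma clique_density_pos: "t \<le> a \<Longrightarrow> 0 < clique_density t a"
  by (cases "a = 0") (auto simp: clique_density_def)

section \<open>Multilinear forms on set systems\<close>

text \<open>
  For \<open>U = {}\<close> this is the multilinear form with coefficients \<open>w\<close> on the set system \<open>C\<close>; in general it is
  the mixed partial derivative of that form with respect to the variables in \<open>U\<close>.  Treating both at once
  makes the expansion in several variables an iteration of \<open>set_poly_upd\<close>.
\<close>

definition set_poly :: "'a set set \<Rightarrow> ('a set \<Rightarrow> real) \<Rightarrow> 'a set \<Rightarrow> ('a \<Rightarrow> real) \<Rightarrow> real" where
  "set_poly C w U y = (\<Sum>K | K \<in> C \<and> U \<subseteq> K. w K * (\<Prod>v\<in>K - U. y v))"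

lemma set_poly_empty: "set_poly C w {} y = (\<Sum>K\<in>C. w K * (\<Prod>v\<in>K. y v))"
  by (simp add: set_poly_def)

lemma set_poly_cong:
  assumes "\<And>v. v \<in> \<Union>C - U \<Longrightarrow> y v = y' v"
  shows "set_poly C w U y = set_poly C w U y'"
  unfolding set_poly_def using assms by (intro sum.cong refl arg_cong[of _ _ "(*) _"] prod.cong) auto

lemma set_poly_nonneg:
  assumes "\<And>K. K \<in> C \<Longrightarrow> 0 \<le> w K" "\<And>v. v \<in> \<Union>C \<Longrightarrow> 0 \<le> y v"
  shows "0 \<le> set_poly C w U y"
  unfolding set_poly_def using assms by (intro sum_nonneg mult_nonneg_nonneg prod_nonneg) auto

lemma set_poly_pos:
  assumes "finite C" "\<And>K. K \<in> C \<Longrightarrow> 0 < w K" "\<And>v. v \<in> \<Union>C \<Longrightarrow> 0 < y v" "K \<in> C" "U \<subseteq> K"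
  shows "0 < set_poly C w U y"
  unfolding set_poly_def using assms
  by (intro sum_pos2[of _ K] mult_nonneg_nonneg mult_pos_pos prod_nonneg prod_pos)
     (auto intro!: less_imp_le)

lemma set_poly_eq_0:
  assumes "\<And>K. K \<in> C \<Longrightarrow> \<not> U \<subseteq> K"
  shows "set_poly C w U y = 0"
  unfolding set_poly_def using assms by (intro sum.neutral) auto

text \<open>
  The form is affine in each variable separately, with the partial derivative as slope.
\<close>

lemma set_poly_upd:
  assumes "finite C" "\<And>K. K \<in> C \<Longrightarrow> finite K" "u \<notin> U"
  shows "set_poly C w U (y(u := z)) = set_poly C w U y + (z - y u) * set_poly C w (insert u U) y"
proof -
  let ?t = "\<lambda>y K. w K * (\<Prod>v\<in>K - U. y v)"
  let ?d = "\<lambda>K. if u \<in> K then (z - y u) * (w K * (\<Prod>v\<in>K - insert u U. y v)) else 0"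
  have "?t (y(u := z)) K = ?t y K + ?d K" if "K \<in> C" for K
  proof (cases "u \<in> K")
    case True
    have eq: "K - U = insert u (K - insert u U)" using True assms(3) by auto
    have prod: "(\<Prod>v\<in>K - U. f v) = f u * (\<Prod>v\<in>K - insert u U. f v)" for f :: "'a \<Rightarrow> real"
      unfolding eq using assms(2)[OF that] by (subst prod.insert) auto
    have "(\<Prod>v\<in>K - insert u U. (y(u := z)) v) = (\<Prod>v\<in>K - insert u U. y v)"
      by (intro prod.cong) auto
    then show ?thesis using True unfolding prod by (simp add: algebra_simps)
  next
    case False
    then have "(\<Prod>v\<in>K - U. (y(u := z)) v) = (\<Prod>v\<in>K - U. y v)"
      by (intro prod.cong) auto
    then show ?thesis using False by simp
  qed
  then have "set_poly C w U (y(u := z)) = (\<Sum>K | K \<in> C \<and> U \<subseteq> K. ?t y K + ?d K)"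
    unfolding set_poly_def by (intro sum.cong) auto
  also have "\<dots> = set_poly C w U y + (\<Sum>K | K \<in> C \<and> U \<subseteq> K. ?d K)"
    by (simp add: sum.distrib set_poly_def)
  also have "(\<Sum>K | K \<in> C \<and> U \<subseteq> K. ?d K) = (\<Sum>K | K \<in> C \<and> insert u U \<subseteq> K. ?d K)"
    using assms(1) by (intro sum.mono_neutral_right) auto
  also have "\<dots> = (z - y u) * set_poly C w (insert u U) y"
    unfolding set_poly_def sum_distrib_left by (intro sum.cong) auto
  finally show ?thesis .
qed

lemma set_poly_Euler:
  assumes "finite V" "finite C" "\<And>K. K \<in> C \<Longrightarrow> K \<subseteq> V \<and> card K = t"
  shows "(\<Sum>v\<in>V. y v * set_poly C w {v} y) = real t * set_poly C w {} y"
proof -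
  have "(\<Sum>v\<in>V. y v * set_poly C w {v} y)
      = (\<Sum>v\<in>V. \<Sum>K | K \<in> C \<and> v \<in> K. w K * (y v * (\<Prod>u\<in>K - {v}. y u)))"
    by (simp add: set_poly_def sum_distrib_left mult_ac)
  also have "\<dots> = (\<Sum>v\<in>V. \<Sum>K | K \<in> C \<and> v \<in> K. w K * (\<Prod>u\<in>K. y u))"
    using assms by (intro sum.cong refl arg_cong[of _ _ "(*) _"] prod.remove[symmetric])
      (auto dest: finite_subset)
  also have "\<dots> = (\<Sum>K\<in>C. \<Sum>v | v \<in> V \<and> v \<in> K. w K * (\<Prod>u\<in>K. y u))"
    using assms by (intro sum.swap_restrict) auto
  also have "\<dots> = (\<Sum>K\<in>C. real t * (w K * (\<Prod>u\<in>K. y u)))"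
  proof (intro sum.cong refl)
    fix K assume "K \<in> C"
    then have "{v. v \<in> V \<and> v \<in> K} = K" "card K = t" using assms(3)[of K] by auto
    then show "(\<Sum>v | v \<in> V \<and> v \<in> K. w K * (\<Prod>u\<in>K. y u)) = real t * (w K * (\<Prod>u\<in>K. y u))" by simp
  qed
  finally show ?thesis by (simp add: set_poly_empty sum_distrib_left)
qed

section \<open>A localised Motzkin--Straus inequality\<close>

text \<open>
  Each clique \<open>K\<close> is weighted according to the largest clique around it, rather than by the clique number of
  the whole graph.  If \<open>u\<close> and \<open>v\<close> are not adjacent, no member of \<open>C\<close> contains both, so the form is affine
  along the line that moves mass between \<open>u\<close> and \<open>v\<close>; moving all of it in the better direction shrinks the support
  without decreasing the value.  Once the support is a clique \<open>S\<close>, every coefficient is at most the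
  reciprocal of the maximum of the elementary symmetric polynomial on \<open>S\<close>, and Maclaurin's inequality
  applies.
\<close>

theorem localised_Motzkin_Straus:
  fixes y :: "'a \<Rightarrow> real"
  assumes "finite V" and C: "\<And>K. K \<in> C \<Longrightarrow> K \<subseteq> V \<and> card K = t \<and> (\<forall>u\<in>K. \<forall>v\<in>K. u \<noteq> v \<longrightarrow> E u v)"
    and sym: "\<And>u v. E u v \<Longrightarrow> E v u"
    and w: "\<And>K S. K \<in> C \<Longrightarrow> K \<subseteq> S \<Longrightarrow> S \<subseteq> V \<Longrightarrow> (\<forall>u\<in>S. \<forall>v\<in>S. u \<noteq> v \<longrightarrow> E u v)
              \<Longrightarrow> w K \<le> 1 / clique_density t (card S)"
    and w0: "\<And>K. K \<in> C \<Longrightarrow> 0 \<le> w K"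
    and y: "\<And>v. v \<in> V \<Longrightarrow> 0 \<le> y v"
  shows "set_poly C w {} y \<le> (\<Sum>v\<in>V. y v) ^ t"
  using y
proof (induction "card {v \<in> V. y v \<noteq> 0}" arbitrary: y rule: less_induct)
  case less
  have finC: "finite C" using C \<open>finite V\<close> by (meson Sup_le_iff Union_Pow_eq finite_UnionD finite_subset)
  have finK: "finite K" if "K \<in> C" for K using C[OF that] \<open>finite V\<close> finite_subset by auto
  define S where "S = {v \<in> V. y v \<noteq> 0}"
  have S: "finite S" "S \<subseteq> V" using \<open>finite V\<close> by (auto simp: S_def)
  show ?case
  proof (cases "\<forall>u\<in>S. \<forall>v\<in>S. u \<noteq> v \<longrightarrow> E u v")
    case True
    have sumS: "(\<Sum>v\<in>V. y v) = (\<Sum>v\<in>S. y v)"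
      using \<open>finite V\<close> by (intro sum.mono_neutral_right) (auto simp: S_def)
    have "set_poly C w {} y = (\<Sum>K | K \<in> C \<and> K \<subseteq> S. w K * (\<Prod>v\<in>K. y v))"
      unfolding set_poly_empty using finC C finK
      by (intro sum.mono_neutral_right) (auto simp: S_def subset_iff)
    also have "\<dots> \<le> (\<Sum>K | K \<in> C \<and> K \<subseteq> S. 1 / clique_density t (card S) * (\<Prod>v\<in>K. y v))"
      using w True S less.prems C by (intro sum_mono mult_right_mono prod_nonneg) blast+
    also have "\<dots> \<le> (\<Sum>K | K \<subseteq> S \<and> card K = t. 1 / clique_density t (card S) * (\<Prod>v\<in>K. y v))"
      using S C less.prems finite_Pow_iff[of S]
      by (intro sum_mono2 mult_nonneg_nonneg prod_nonneg)
         (auto simp: clique_density_nonneg intro: finite_subset[of _ "Pow S"])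
    also have "\<dots> = 1 / clique_density t (card S) * elem_sym t S y"
      by (simp add: elem_sym_def sum_distrib_left)
    also have "\<dots> \<le> 1 / clique_density t (card S) * (clique_density t (card S) * (\<Sum>v\<in>V. y v) ^ t)"
      using Maclaurin_ineq[of S y t] S less.prems unfolding sumS
      by (intro mult_left_mono) (auto simp: clique_density_nonneg clique_density_def power_divide)
    also have "\<dots> \<le> (\<Sum>v\<in>V. y v) ^ t"
      using less.prems by (auto intro!: zero_le_power sum_nonneg)
    finally show ?thesis .
  next
    case False
    then obtain u v where uv: "u \<in> S" "v \<in> S" "u \<noteq> v" "\<not> E u v" by auto
    have "\<exists>u v. u \<in> S \<and> v \<in> S \<and> u \<noteq> v \<and> \<not> E u v \<and> set_poly C w {v} y \<le> set_poly C w {u} y"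
      using uv sym by (metis linear)
    then obtain u v where uv: "u \<in> S" "v \<in> S" "u \<noteq> v" "\<not> E u v"
      and le: "set_poly C w {v} y \<le> set_poly C w {u} y" by blast
    \<comment> \<open>the whole mass of \<open>v\<close> moves to \<open>u\<close>, where the slope is at least as large\<close>
    define y' where "y' = y(u := y u + y v, v := 0)"
    have none: "\<not> {v, u} \<subseteq> K" if "K \<in> C" for K using C[OF that] uv by blast
    have "set_poly C w {} y' = set_poly C w {} (y(u := y u + y v)) - y v * set_poly C w {v} (y(u := y u + y v))"
      unfolding y'_def using uv finC finK by (subst set_poly_upd) auto
    also have "set_poly C w {v} (y(u := y u + y v)) = set_poly C w {v} y + y v * set_poly C w {u, v} y"
      using uv finC finK by (subst set_poly_upd) auto
    also have "set_poly C w {u, v} y = 0"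
      using none by (intro set_poly_eq_0) (auto simp: insert_commute)
    also have "set_poly C w {} (y(u := y u + y v)) = set_poly C w {} y + y v * set_poly C w {u} y"
      using finC finK by (subst set_poly_upd) auto
    finally have "set_poly C w {} y' = set_poly C w {} y + y v * (set_poly C w {u} y - set_poly C w {v} y)"
      by (simp add: algebra_simps)
    moreover have "0 \<le> y v" using less.prems uv S by auto
    ultimately have "set_poly C w {} y \<le> set_poly C w {} y'" using le by simp
    also have "\<dots> \<le> (\<Sum>v\<in>V. y' v) ^ t"
    proof (rule less.hyps)
      have "{x \<in> V. y' x \<noteq> 0} \<subseteq> {x \<in> V. y x \<noteq> 0} - {v}"
        using uv by (auto simp: y'_def S_def)
      then show "card {x \<in> V. y' x \<noteq> 0} < card {x \<in> V. y x \<noteq> 0}"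
        using uv \<open>finite V\<close> by (intro psubset_card_mono) (auto simp: S_def)
      show "0 \<le> y' x" if "x \<in> V" for x using less.prems that uv S by (auto simp: y'_def)
    qed
    also have "(\<Sum>v\<in>V. y' v) = (\<Sum>v\<in>V. y v)"
    proof -
      have "(\<Sum>v\<in>V. f v) = f u + f v + (\<Sum>v\<in>V - {u} - {v}. f v)" for f :: "'a \<Rightarrow> real"
        using uv S \<open>finite V\<close> by (subst sum.remove[of V u], simp, force, subst sum.remove[of _ v]) auto
      note this[of y] this[of y']
      moreover have "(\<Sum>v\<in>V - {u} - {v}. y' v) = (\<Sum>v\<in>V - {u} - {v}. y v)"
        by (intro sum.cong) (auto simp: y'_def)
      ultimately show ?thesis using uv by (simp add: y'_def)
    qed
    finally show ?thesis .
  qed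
qed

text \<open>
  At a maximiser that is positive on \<open>\<Union>C\<close>, lying in no common member of \<open>C\<close> is a transitive relation.  Suppose
  \<open>u\<close> and \<open>x\<close> lie in a common member, but \<open>v\<close> shares one with neither.  Along the line that adds \<open>s\<close> to the
  variables of \<open>u\<close> and \<open>x\<close> and takes \<open>2 * s\<close> from that of \<open>v\<close>, the form is quadratic and its only second-order
  term comes from the members containing \<open>u\<close> and \<open>x\<close>.  So it is strictly convex, and one of the points \<open>s\<close>,
  \<open>- s\<close> gives a larger value on the same simplex.
\<close>

lemma maximiser_cooccurrence:
  fixes y :: "'a \<Rightarrow> real"
  assumes "finite V" "finite C" and C: "\<And>K. K \<in> C \<Longrightarrow> K \<subseteq> V"
    and bound: "\<And>z. (\<And>v. v \<in> V \<Longrightarrow> 0 \<le> z v) \<Longrightarrow> set_poly C w {} z \<le> (\<Sum>v\<in>V. z v) ^ t"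
    and eq: "set_poly C w {} y = (\<Sum>v\<in>V. y v) ^ t"
    and y0: "\<And>v. v \<in> V \<Longrightarrow> 0 \<le> y v" and pos: "\<And>v. v \<in> \<Union>C \<Longrightarrow> 0 < y v"
    and w: "\<And>K. K \<in> C \<Longrightarrow> 0 < w K"
    and K: "K \<in> C" "u \<in> K" "x \<in> K" "u \<noteq> x" and v: "v \<in> \<Union>C" "v \<noteq> u" "v \<noteq> x"
    and nu: "\<And>L. L \<in> C \<Longrightarrow> \<not> {u, v} \<subseteq> L"
  shows "\<exists>L\<in>C. {v, x} \<subseteq> L"
proof (rule ccontr)
  assume "\<not> ?thesis"
  then have nx: "\<And>L. L \<in> C \<Longrightarrow> \<not> {x, v} \<subseteq> L" by auto
  have finK: "finite L" if "L \<in> C" for L using C[OF that] \<open>finite V\<close> finite_subset by auto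
  define z where "z s = y(u := y u + s, x := y x + s, v := y v - 2 * s)" for s
  let ?D = "\<lambda>U. set_poly C w U y"
  have expand: "set_poly C w {} (z s) = ?D {} + s * (?D {u} + ?D {x} - 2 * ?D {v}) + s\<^sup>2 * ?D {u, x}" for s
  proof -
    let ?y1 = "y(u := y u + s)" and ?y2 = "y(u := y u + s, x := y x + s)"
    have "set_poly C w {} (z s) = set_poly C w {} ?y2 - 2 * s * set_poly C w {v} ?y2"
      unfolding z_def using assms(2) finK v by (subst set_poly_upd) auto
    also have "set_poly C w {v} ?y2 = set_poly C w {v} ?y1 + s * set_poly C w {x, v} ?y1"
      using assms(2) finK v K by (subst set_poly_upd) auto
    also have "set_poly C w {x, v} ?y1 = 0" using nx by (rule set_poly_eq_0)
    also have "set_poly C w {v} ?y1 = ?D {v} + s * ?D {u, v}"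
      using assms(2) finK v by (subst set_poly_upd) auto
    also have "?D {u, v} = 0" using nu by (rule set_poly_eq_0)
    also have "set_poly C w {} ?y2 = set_poly C w {} ?y1 + s * set_poly C w {x} ?y1"
      using assms(2) finK K by (subst set_poly_upd) auto
    also have "set_poly C w {} ?y1 = ?D {} + s * ?D {u}"
      using assms(2) finK by (subst set_poly_upd) auto
    also have "set_poly C w {x} ?y1 = ?D {x} + s * ?D {u, x}"
      using assms(2) finK K by (subst set_poly_upd) auto
    finally show ?thesis by (simp add: algebra_simps power2_eq_square)
  qed
  have inV: "u \<in> V" "x \<in> V" "v \<in> V" using C K v by auto
  have sum: "(\<Sum>a\<in>V. z s a) = (\<Sum>a\<in>V. y a)" for s
  proof -
    have "(\<Sum>a\<in>V. f a) = f u + f x + f v + (\<Sum>a\<in>V - {u, x, v}. f a)" for f :: "'a \<Rightarrow> real"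
    proof -
      have "V = insert u (insert x (insert v (V - {u, x, v})))" using inV by auto
      then have "(\<Sum>a\<in>V. f a) = (\<Sum>a\<in>insert u (insert x (insert v (V - {u, x, v}))). f a)" by simp
      then show ?thesis using K v \<open>finite V\<close> by (simp add: sum.insert_if)
    qed
    note this[of y] this[of "z s"]
    moreover have "(\<Sum>a\<in>V - {u, x, v}. z s a) = (\<Sum>a\<in>V - {u, x, v}. y a)"
      by (intro sum.cong) (auto simp: z_def)
    ultimately show ?thesis using K v by (simp add: z_def)
  qed
  \<comment> \<open>small enough to keep all coordinates nonnegative at both \<open>s\<close> and \<open>- s\<close>\<close>
  define s where "s = Min {y u, y x, y v} / 2"
  have s: "0 < s" "2 * s \<le> y u" "2 * s \<le> y x" "2 * s \<le> y v"
    using pos K v unfolding s_def by auto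
  have bd: "set_poly C w {} (z r) \<le> ?D {}" if "\<bar>r\<bar> = s" for r
  proof -
    have "0 \<le> z r a" if "a \<in> V" for a
      using s y0[OF that] \<open>\<bar>r\<bar> = s\<close> by (auto simp: z_def)
    then have "set_poly C w {} (z r) \<le> (\<Sum>v\<in>V. z r v) ^ t" by (rule bound)
    then show ?thesis using sum eq by simp
  qed
  have "0 < s\<^sup>2 * ?D {u, x}"
    using s assms K by (intro mult_pos_pos set_poly_pos[of _ _ _ K]) auto
  moreover have "set_poly C w {} (z s) + set_poly C w {} (z (- s)) = 2 * ?D {} + 2 * (s\<^sup>2 * ?D {u, x})"
    by (simp add: expand algebra_simps)
  ultimately show False using bd[of s] bd[of "- s"] s by simp
qed

section \<open>The spectral radius of the clique tensor as a maximum\<close>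

abbreviation edge_poly :: "'a set set \<Rightarrow> 'a set \<Rightarrow> ('a \<Rightarrow> real) \<Rightarrow> real" where
  "edge_poly C \<equiv> set_poly C (\<lambda>_. 1)"

lemma edge_poly_scale:
  assumes "\<And>K. K \<in> C \<Longrightarrow> card K = t"
  shows "edge_poly C {} (\<lambda>v. r * y v) = r ^ t * edge_poly C {} y"
  unfolding set_poly_empty sum_distrib_left
  using assms by (intro sum.cong refl) (auto simp: prod.distrib)

text \<open>
  By compactness the form attains its maximum on the nonnegative part of the \<open>t\<close>-norm unit sphere.  The
  conclusion is stated in homogeneous form, which makes it usable for perturbations that leave the sphere.
\<close>

lemma edge_poly_maximiser:
  assumes "finite V" "V \<noteq> {}" "0 < t" and C: "\<And>K. K \<in> C \<Longrightarrow> K \<subseteq> V \<and> card K = t"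
  obtains x where "\<And>v. 0 \<le> x v" "(\<Sum>v\<in>V. x v ^ t) = 1"
    "\<And>z. (\<And>v. v \<in> V \<Longrightarrow> 0 \<le> z v) \<Longrightarrow> edge_poly C {} z \<le> edge_poly C {} x * (\<Sum>v\<in>V. z v ^ t)"
proof -
  \<comment> \<open>coordinates outside \<open>V\<close> are fixed to \<open>0\<close>: the product of the other intervals is then compact\<close>
  define B :: "('a \<Rightarrow> real) set" where "B = Pi UNIV (\<lambda>v. if v \<in> V then {0..1} else {0})"
  define S where "S = B \<inter> {x. (\<Sum>v\<in>V. x v ^ t) = 1}"
  have "compactin (product_topology (\<lambda>_. euclidean) UNIV) (PiE UNIV (\<lambda>v. if v \<in> V then {0..1::real} else {0}))"
    unfolding compactin_PiE by auto
  then have "compact B"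
    unfolding euclidean_product_topology B_def by (simp add: PiE_UNIV_domain)
  moreover have "closed {x :: 'a \<Rightarrow> real. (\<Sum>v\<in>V. x v ^ t) = 1}"
    by (intro closed_Collect_eq continuous_intros) auto
  ultimately have "compact S" unfolding S_def by (rule compact_Int_closed)
  moreover have "S \<noteq> {}"
  proof -
    obtain a where "a \<in> V" using \<open>V \<noteq> {}\<close> by auto
    then have "(\<lambda>v. if v = a then 1 else 0) \<in> S"
      using assms(1,3) by (auto simp: S_def B_def power_0_left if_distrib[of "\<lambda>x. x ^ t"] cong: if_cong)
    then show ?thesis by auto
  qed
  moreover have "continuous_on S (edge_poly C {})"
    unfolding set_poly_empty
    by (rule continuous_on_subset[of UNIV]) (auto intro!: continuous_intros)
  ultimately obtain x where x: "x \<in> S" and max: "\<And>z. z \<in> S \<Longrightarrow> edge_poly C {} z \<le> edge_poly C {} x"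
    using continuous_attains_sup[of S "edge_poly C {}"] by blast
  show ?thesis
  proof
    show "0 \<le> x v" for v using x by (cases "v \<in> V") (auto simp: S_def B_def Pi_iff split: if_splits)
    show "(\<Sum>v\<in>V. x v ^ t) = 1" using x by (simp add: S_def)
    fix z :: "'a \<Rightarrow> real" assume z: "\<And>v. v \<in> V \<Longrightarrow> 0 \<le> z v"
    define N where "N = (\<Sum>v\<in>V. z v ^ t)"
    have N: "0 \<le> N" unfolding N_def using z by (intro sum_nonneg) auto
    show "edge_poly C {} z \<le> edge_poly C {} x * (\<Sum>v\<in>V. z v ^ t)"
    proof (cases "N = 0")
      case True
      then have "\<forall>v\<in>V. z v ^ t = 0"
        unfolding N_def using sum_nonneg_eq_0_iff[OF \<open>finite V\<close>, of "\<lambda>v. z v ^ t"] z by auto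
      then have z0: "z v = 0" if "v \<in> V" for v using that \<open>0 < t\<close> by auto
      have "edge_poly C {} z = 0"
        unfolding set_poly_empty
      proof (intro sum.neutral ballI)
        fix K assume "K \<in> C"
        then have "K \<subseteq> V" "card K = t" using C by auto
        moreover then obtain v where "v \<in> K" using \<open>0 < t\<close> by fastforce
        ultimately show "1 * (\<Prod>v\<in>K. z v) = 0"
          using z0 \<open>finite V\<close> by (auto intro!: prod_zero dest: finite_subset)
      qed
      then show ?thesis using True by (simp add: N_def)
    next
      case False
      define r where "r = root t N"
      have r: "0 < r" "r ^ t = N" using False N \<open>0 < t\<close> by (auto simp: r_def)
      define z' where "z' v = (if v \<in> V then inverse r * z v else 0)" for v
      have "(\<Sum>v\<in>V. z' v ^ t) = inverse (r ^ t) * N"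
        unfolding N_def sum_distrib_left by (intro sum.cong) (auto simp: z'_def power_mult_distrib power_inverse)
      then have sum1: "(\<Sum>v\<in>V. z' v ^ t) = 1" using r False by simp
      have "z' v \<le> 1" "0 \<le> z' v" if "v \<in> V" for v
      proof -
        show "0 \<le> z' v" using r z that by (auto simp: z'_def)
        have "z' v ^ t \<le> (\<Sum>v\<in>V. z' v ^ t)"
          using r z that \<open>finite V\<close> by (intro member_le_sum) (auto simp: z'_def)
        then show "z' v \<le> 1" using sum1 \<open>0 < t\<close> \<open>0 \<le> z' v\<close>
          by (metis power_le_one_iff not_gr0)
      qed
      then have "z' \<in> S" using sum1 by (auto simp: S_def B_def z'_def)
      then have "edge_poly C {} z' \<le> edge_poly C {} x" by (rule max)
      moreover have "edge_poly C {} z' = edge_poly C {} (\<lambda>v. inverse r * z v)"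
        using C by (intro set_poly_cong) (auto simp: z'_def)
      moreover have "\<dots> = inverse (r ^ t) * edge_poly C {} z"
        using C by (subst edge_poly_scale[of _ t]) (auto simp: power_inverse)
      ultimately have "inverse N * edge_poly C {} z \<le> edge_poly C {} x" using r by simp
      then show ?thesis using N False by (simp add: N_def[symmetric] field_simps)
    qed
  qed
qed

text \<open>
  These are the Lagrange conditions, obtained by varying one coordinate at a time.  At a positive
  coordinate the variation is two-sided and the derivative vanishes.  At a zero coordinate only increases are
  possible; the \<open>t\<close>-th power of the norm then grows like \<open>a ^ t\<close> with \<open>t \<ge> 2\<close> while the form grows linearly, so the
  slope of the form is zero as well.
\<close>

lemma edge_poly_maximiser_eigen:
  assumes "finite V" "2 \<le> t" and C: "\<And>K. K \<in> C \<Longrightarrow> K \<subseteq> V \<and> card K = t"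
    and x: "\<And>v. v \<in> V \<Longrightarrow> 0 \<le> x v" "(\<Sum>v\<in>V. x v ^ t) = 1"
    and max: "\<And>z. (\<And>v. v \<in> V \<Longrightarrow> 0 \<le> z v) \<Longrightarrow> edge_poly C {} z \<le> M * (\<Sum>v\<in>V. z v ^ t)"
    and M: "M = edge_poly C {} x" and "i \<in> V"
  shows "edge_poly C {i} x = real t * M * x i ^ (t - 1)"
proof -
  have finC: "finite C" using C \<open>finite V\<close> by (meson Sup_le_iff Union_Pow_eq finite_UnionD finite_subset)
  have finK: "finite K" if "K \<in> C" for K using C[OF that] \<open>finite V\<close> finite_subset by auto
  let ?d = "edge_poly C {i} x"
  have key: "(a - x i) * ?d \<le> M * (a ^ t - x i ^ t)" if "0 \<le> a" for a
  proof -
    have "edge_poly C {} (x(i := a)) = M + (a - x i) * ?d"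
      using finC finK by (subst set_poly_upd) (auto simp: M)
    moreover have "(\<Sum>v\<in>V. (x(i := a)) v ^ t) = 1 + a ^ t - x i ^ t"
    proof -
      have "(\<Sum>v\<in>V. f v) = f i + (\<Sum>v\<in>V - {i}. f v)" for f :: "'a \<Rightarrow> real"
        using \<open>finite V\<close> \<open>i \<in> V\<close> by (intro sum.remove)
      note this[of "\<lambda>v. x v ^ t"] this[of "\<lambda>v. (x(i := a)) v ^ t"]
      moreover have "(\<Sum>v\<in>V - {i}. (x(i := a)) v ^ t) = (\<Sum>v\<in>V - {i}. x v ^ t)"
        by (intro sum.cong) auto
      ultimately show ?thesis using x(2) by simp
    qed
    moreover have "edge_poly C {} (x(i := a)) \<le> M * (\<Sum>v\<in>V. (x(i := a)) v ^ t)"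
      using x(1) that by (intro max) auto
    ultimately have "M + (a - x i) * ?d \<le> M * (1 + a ^ t - x i ^ t)" by simp
    then show ?thesis by (simp add: algebra_simps)
  qed
  show ?thesis
  proof (cases "x i = 0")
    case False
    then have "0 < x i" using x(1)[OF \<open>i \<in> V\<close>] by simp
    let ?g = "\<lambda>a. M * (a ^ t - x i ^ t) - (a - x i) * ?d"
    have "(?g has_real_derivative M * (real t * x i ^ (t - 1)) - ?d) (at (x i))"
      by (auto intro!: derivative_eq_intros)
    moreover have "\<forall>a. \<bar>x i - a\<bar> < x i \<longrightarrow> ?g (x i) \<le> ?g a"
      using key by auto
    ultimately have "M * (real t * x i ^ (t - 1)) - ?d = 0"
      by (rule DERIV_local_min[OF _ \<open>0 < x i\<close>])
    then show ?thesis by (simp add: algebra_simps)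
  next
    case True
    have "\<Union>C \<subseteq> V" using C by blast
    then have "0 \<le> ?d" using x(1) by (intro set_poly_nonneg) auto
    moreover have "?d \<le> 0"
    proof (rule tendsto_lowerbound)
      show "((\<lambda>a. M * a ^ (t - 1)) \<longlongrightarrow> 0) (at_right 0)"
        using \<open>2 \<le> t\<close> by (auto intro!: tendsto_eq_intros)
      show "\<forall>\<^sub>F a in at_right 0. ?d \<le> M * a ^ (t - 1)"
      proof (rule eventually_mono[OF eventually_at_right_less])
        fix a :: real assume "0 < a"
        then have "a * ?d \<le> a * (M * a ^ (t - 1))"
          using key[of a] True \<open>2 \<le> t\<close> by (cases t) (auto simp: mult_ac power_0_left)
        then show "?d \<le> M * a ^ (t - 1)" using \<open>0 < a\<close> by simp
      qed
    qed auto
    ultimately show ?thesis using True \<open>2 \<le> t\<close> by (simp add: power_0_left)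
  qed
qed

text \<open>
  A clique \<open>K\<close> containing \<open>i\<close> is met once for each ordering of \<open>K - {i}\<close>, which the factor
  \<open>1 / fact (t - 1)\<close> in the tensor compensates.
\<close>

lemma clique_tensor_sum:
  fixes x :: "'a \<Rightarrow> complex"
  assumes "finite V" and C: "\<And>K. K \<in> cliques_of_size G t \<Longrightarrow> K \<subseteq> V" and "0 < t" "i \<in> V"
  shows "(\<Sum>js | set js \<subseteq> V \<and> length js = t - 1. clique_tensor G t (i # js) * (\<Prod>j\<leftarrow>js. x j))
       = (\<Sum>K | K \<in> cliques_of_size G t \<and> i \<in> K. \<Prod>v\<in>K - {i}. x v)"
proof -
  let ?C = "cliques_of_size G t"
  define L where "L = {js. set js \<subseteq> V \<and> length js = t - 1 \<and> insert i (set js) \<in> ?C}"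
  have finC: "finite ?C" using C \<open>finite V\<close> by (meson Sup_le_iff Union_Pow_eq finite_UnionD finite_subset)
  have fin: "finite {js. set js \<subseteq> V \<and> length js = t - 1}"
    using \<open>finite V\<close> by (rule finite_lists_length_eq)
  then have finL: "finite L" by (rule rev_finite_subset) (auto simp: L_def)
  have "(\<Sum>js | set js \<subseteq> V \<and> length js = t - 1. clique_tensor G t (i # js) * (\<Prod>j\<leftarrow>js. x j))
      = (\<Sum>js\<in>L. clique_tensor G t (i # js) * (\<Prod>j\<leftarrow>js. x j))"
    using fin by (intro sum.mono_neutral_right) (auto simp: L_def clique_tensor_def)
  also have "\<dots> = (\<Sum>js\<in>L. (\<Prod>j\<leftarrow>js. x j) / fact (t - 1))"
    using \<open>0 < t\<close> by (intro sum.cong) (auto simp: L_def clique_tensor_def)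
  also have "\<dots> = (\<Sum>K | K \<in> ?C \<and> i \<in> K. \<Sum>js | js \<in> L \<and> insert i (set js) = K. (\<Prod>j\<leftarrow>js. x j) / fact (t - 1))"
    using finL finC by (intro sum.group[symmetric]) (auto simp: L_def)
  also have "\<dots> = (\<Sum>K | K \<in> ?C \<and> i \<in> K. \<Prod>v\<in>K - {i}. x v)"
  proof (intro sum.cong refl)
    fix K assume "K \<in> {K. K \<in> ?C \<and> i \<in> K}"
    then have K: "K \<in> ?C" "i \<in> K" "card K = t" "K \<subseteq> V"
      using C[of K] by (auto simp: cliques_of_size_def)
    then have "finite K" using \<open>finite V\<close> finite_subset by auto
    then have card: "card (K - {i}) = t - 1" using K by simp
    have "{js. js \<in> L \<and> insert i (set js) = K} = permutations_of_set (K - {i})"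
    proof (intro equalityI subsetI)
      fix js assume "js \<in> {js. js \<in> L \<and> insert i (set js) = K}"
      then have js: "insert i (set js) = K" "length js = t - 1" by (auto simp: L_def)
      then have "K - {i} \<subseteq> set js" by auto
      moreover have "card (set js) \<le> card (K - {i})" using card js card_length[of js] by simp
      ultimately have "set js = K - {i}" by (metis card_seteq List.finite_set)
      then show "js \<in> permutations_of_set (K - {i})"
        using js card by (auto intro!: permutations_of_setI card_distinct)
    next
      fix js assume "js \<in> permutations_of_set (K - {i})"
      then have "set js = K - {i}" "distinct js" by (auto dest: permutations_of_setD)
      then show "js \<in> {js. js \<in> L \<and> insert i (set js) = K}"
        using K card \<open>finite K\<close> by (auto simp: L_def insert_absorb distinct_card[symmetric])
    qed
    then have "(\<Sum>js | js \<in> L \<and> insert i (set js) = K. (\<Prod>j\<leftarrow>js. x j) / fact (t - 1))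
        = (\<Sum>js\<in>permutations_of_set (K - {i}). (\<Prod>v\<in>K - {i}. x v) / fact (t - 1))"
      by (intro sum.cong) (simp_all add: prod.distinct_set_conv_list[symmetric] permutations_of_setD)
    also have "\<dots> = (\<Prod>v\<in>K - {i}. x v)" using \<open>finite K\<close> card by simp
    finally show "(\<Sum>js | js \<in> L \<and> insert i (set js) = K. (\<Prod>j\<leftarrow>js. x j) / fact (t - 1))
        = (\<Prod>v\<in>K - {i}. x v)" .
  qed
  finally show ?thesis .
qed

text \<open>
  The maximiser of the clique form on the sphere is an eigenvector.  Conversely, taking absolute values in
  the eigenvalue equation of any complex eigenvector \<open>z\<close> and pairing it with \<open>\<bar>z\<bar>\<close> shows, by Euler's identity for
  homogeneous forms, that no eigenvalue has larger modulus.
\<close>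

theorem clique_spectral_radius_variational:
  assumes "finite (pverts G)" "pverts G \<noteq> {}" "2 \<le> t"
  obtains x where "\<And>v. 0 \<le> x v" "(\<Sum>v\<in>pverts G. x v ^ t) = 1"
    "clique_spectral_radius G t = real t * edge_poly (cliques_of_size G t) {} x"
    "\<And>z. (\<And>v. v \<in> pverts G \<Longrightarrow> 0 \<le> z v) \<Longrightarrow>
      real t * edge_poly (cliques_of_size G t) {} z \<le> clique_spectral_radius G t * (\<Sum>v\<in>pverts G. z v ^ t)"
proof -
  let ?V = "pverts G" and ?C = "cliques_of_size G t"
  let ?P = "edge_poly ?C"
  have C: "K \<subseteq> ?V \<and> card K = t" if "K \<in> ?C" for K
    using that by (auto simp: cliques_of_size_def clique_def)
  then have finC: "finite ?C" using assms(1) by (meson Sup_le_iff Union_Pow_eq finite_UnionD finite_subset)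
  obtain x where x: "\<And>v. 0 \<le> x v" "(\<Sum>v\<in>?V. x v ^ t) = 1"
    and max: "\<And>z. (\<And>v. v \<in> ?V \<Longrightarrow> 0 \<le> z v) \<Longrightarrow> ?P {} z \<le> ?P {} x * (\<Sum>v\<in>?V. z v ^ t)"
    using edge_poly_maximiser[OF assms(1,2), of t ?C] C assms(3) by auto
  define \<rho> where "\<rho> = real t * ?P {} x"
  have \<rho>0: "0 \<le> \<rho>" unfolding \<rho>_def using x by (intro mult_nonneg_nonneg set_poly_nonneg) auto
  have eigen: "tensor_eigenvalue t ?V (clique_tensor G t) (complex_of_real \<rho>)"
    unfolding tensor_eigenvalue_def
  proof (intro exI conjI ballI)
    show "\<exists>i\<in>?V. complex_of_real (x i) \<noteq> 0"
    proof (rule ccontr)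
      assume "\<not> ?thesis"
      then have "(\<Sum>v\<in>?V. x v ^ t) = 0" using assms(3) by (intro sum.neutral) auto
      then show False using x by simp
    qed
    fix i assume i: "i \<in> ?V"
    have "(\<Sum>js | set js \<subseteq> ?V \<and> length js = t - 1. clique_tensor G t (i # js) * (\<Prod>j\<leftarrow>js. complex_of_real (x j)))
        = (\<Sum>K | K \<in> ?C \<and> i \<in> K. \<Prod>v\<in>K - {i}. complex_of_real (x v))"
      using assms i C by (intro clique_tensor_sum) auto
    also have "\<dots> = complex_of_real (?P {i} x)" by (simp add: set_poly_def)
    also have "?P {i} x = \<rho> * x i ^ (t - 1)"
      unfolding \<rho>_def using assms C x max i by (intro edge_poly_maximiser_eigen) auto
    finally show "(\<Sum>js | set js \<subseteq> ?V \<and> length js = t - 1. clique_tensor G t (i # js) * (\<Prod>j\<leftarrow>js. complex_of_real (x j)))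
        = complex_of_real \<rho> * complex_of_real (x i) ^ (t - 1)" by simp
  qed
  have upper: "cmod \<mu> \<le> \<rho>" if ev: "tensor_eigenvalue t ?V (clique_tensor G t) \<mu>" for \<mu>
  proof -
    obtain z where z: "\<exists>i\<in>?V. z i \<noteq> 0" and
      eq: "\<And>i. i \<in> ?V \<Longrightarrow> (\<Sum>js | set js \<subseteq> ?V \<and> length js = t - 1. clique_tensor G t (i # js) * (\<Prod>j\<leftarrow>js. z j))
                = \<mu> * z i ^ (t - 1)"
      using ev unfolding tensor_eigenvalue_def by blast
    define a where "a v = cmod (z v)" for v
    have "cmod \<mu> * a i ^ (t - 1) \<le> ?P {i} a" if i: "i \<in> ?V" for i
    proof -
      have "(\<Sum>K | K \<in> ?C \<and> i \<in> K. \<Prod>v\<in>K - {i}. z v) = \<mu> * z i ^ (t - 1)"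
        unfolding eq[OF i, symmetric] using assms C i by (intro clique_tensor_sum[symmetric]) auto
      then have "cmod \<mu> * a i ^ (t - 1) = cmod (\<Sum>K | K \<in> ?C \<and> i \<in> K. \<Prod>v\<in>K - {i}. z v)"
        by (simp add: a_def norm_mult norm_power)
      also have "\<dots> \<le> (\<Sum>K | K \<in> ?C \<and> i \<in> K. cmod (\<Prod>v\<in>K - {i}. z v))" by (rule norm_sum)
      finally show ?thesis by (simp add: set_poly_def a_def prod_norm)
    qed
    then have "(\<Sum>i\<in>?V. a i * (cmod \<mu> * a i ^ (t - 1))) \<le> (\<Sum>i\<in>?V. a i * ?P {i} a)"
      by (intro sum_mono mult_left_mono) (auto simp: a_def)
    also have "\<dots> = real t * ?P {} a"
      using assms finC C by (intro set_poly_Euler) auto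
    also have "\<dots> \<le> \<rho> * (\<Sum>v\<in>?V. a v ^ t)"
      using max[of a] unfolding \<rho>_def by (simp add: a_def mult.assoc mult_left_mono)
    finally have "cmod \<mu> * (\<Sum>i\<in>?V. a i ^ t) \<le> \<rho> * (\<Sum>v\<in>?V. a v ^ t)"
      using assms(3) by (cases t) (auto simp: sum_distrib_left mult_ac)
    moreover have "0 < (\<Sum>v\<in>?V. a v ^ t)"
    proof -
      obtain i where "i \<in> ?V" "z i \<noteq> 0" using z by auto
      then show ?thesis using assms(1) by (intro sum_pos2[of _ i]) (auto simp: a_def)
    qed
    ultimately show ?thesis by simp
  qed
  have "clique_spectral_radius G t = \<rho>"
    unfolding clique_spectral_radius_def tensor_spectral_radius_def
    using eigen upper \<rho>0 by (intro Greatest_equality) (auto intro!: exI[of _ "complex_of_real \<rho>"])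
  then show ?thesis
    using that[of x] x max assms(3) by (auto simp: \<rho>_def mult.assoc)
qed

section \<open>Cliques\<close>

text \<open>
  The graph induced on \<open>K\<close> is complete as soon as the pairs of distinct vertices of \<open>K\<close> are arcs, since there are no
  loops.
\<close>

lemma clique_iff:
  assumes "pair_graph G"
  shows "clique G K \<longleftrightarrow> K \<subseteq> pverts G \<and> (\<forall>u\<in>K. \<forall>v\<in>K. u \<noteq> v \<longrightarrow> (u, v) \<in> parcs G)"
proof -
  interpret pair_graph G by fact
  have eq: "with_proj G \<restriction> K = with_proj \<lparr>pverts = K, parcs = {e \<in> parcs G. fst e \<in> K \<and> snd e \<in> K}\<rparr>"
    by (simp add: induce_subgraph_def with_proj_def)
  then have "clique G K \<longleftrightarrow> K \<subseteq> pverts G \<and> finite K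
      \<and> {e \<in> parcs G. fst e \<in> K \<and> snd e \<in> K} = {(u, v). (u, v) \<in> K \<times> K \<and> u \<noteq> v}"
    unfolding clique_def eq complete_digraph_pair_def by simp
  also have "\<dots> \<longleftrightarrow> K \<subseteq> pverts G \<and> (\<forall>u\<in>K. \<forall>v\<in>K. u \<noteq> v \<longrightarrow> (u, v) \<in> parcs G)"
  proof -
    have "u \<noteq> v" if "(u, v) \<in> parcs G" for u v using pair_no_loops[OF that] by simp
    moreover have "finite K" if "K \<subseteq> pverts G" using that pair_finite_verts by (rule finite_subset)
    ultimately show ?thesis by auto
  qed
  finally show ?thesis .
qed

lemma clique_subset:
  assumes "pair_graph G" "clique G K" "L \<subseteq> K"
  shows "clique G L"
  using assms by (auto simp: clique_iff)

lemma finite_cliques: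
  assumes "pair_graph G"
  shows "finite {K. clique G K}"
proof -
  interpret pair_graph G by fact
  show ?thesis
    by (rule finite_subset[of _ "Pow (pverts G)"]) (auto simp: clique_def pair_finite_verts)
qed

lemma card_le_clique_number:
  assumes "pair_graph G" "clique G K"
  shows "card K \<le> clique_number G"
  unfolding clique_number_def using assms finite_cliques[OF assms(1)] by (intro Max_ge) auto

lemma clique_number_attained:
  assumes "pair_graph G"
  obtains K where "clique G K" "card K = clique_number G"
proof -
  have "clique G {}" using assms by (simp add: clique_iff)
  then have "clique_number G \<in> card ` {K. clique G K}"
    unfolding clique_number_def using finite_cliques[OF assms] by (intro Max_in) auto
  then show ?thesis using that by auto
qed

lemma card_le_vertex_clique_number:
  assumes "pair_graph G" "clique G K" "v \<in> K"
  shows "card K \<le> vertex_clique_number G v"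
  unfolding vertex_clique_number_def using assms finite_cliques[OF assms(1)]
  by (intro Max_ge) (auto intro: rev_finite_subset)

lemma vertex_clique_number_le:
  assumes "pair_graph G" "v \<in> pverts G"
  shows "vertex_clique_number G v \<le> clique_number G"
proof -
  have "clique G {v}" using assms by (simp add: clique_iff)
  then have "vertex_clique_number G v \<in> card ` {K. clique G K \<and> v \<in> K}"
    unfolding vertex_clique_number_def using finite_cliques[OF assms(1)]
    by (intro Max_in) (auto intro: rev_finite_subset)
  then show ?thesis using card_le_clique_number[OF assms(1)] by auto
qed

section \<open>Transversals and complete multipartite graphs\<close>

text \<open>
  In a complete multipartite graph with classes \<open>P\<close>, these are the cliques.
\<close>

definition partial_transversal :: "'a set set \<Rightarrow> 'a set \<Rightarrow> bool" where
  "partial_transversal P K \<longleftrightarrow>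
     K \<subseteq> \<Union>P \<and> (\<forall>u\<in>K. \<forall>v\<in>K. u \<noteq> v \<longrightarrow> \<not> (\<exists>A\<in>P. u \<in> A \<and> v \<in> A))"

lemma partition_on_same:
  "partition_on W P \<Longrightarrow> A \<in> P \<Longrightarrow> B \<in> P \<Longrightarrow> v \<in> A \<Longrightarrow> v \<in> B \<Longrightarrow> A = B"
  by (metis IntI disjointD empty_iff partition_onD2)

lemma partial_transversal_choice:
  assumes "partition_on W P" "T \<subseteq> P" "\<And>A. A \<in> T \<Longrightarrow> c A \<in> A"
  shows "inj_on c T" "partial_transversal P (c ` T)"
proof -
  have same: "A = B" if "A \<in> T" "B \<in> T" "C \<in> P" "c A \<in> C" "c B \<in> C" for A B C
  proof -
    have "A \<in> P" "B \<in> P" "c A \<in> A" "c B \<in> B" using assms(2,3) that by auto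
    then have "A = C" "B = C"
      using partition_on_same[OF assms(1), of A C "c A"] partition_on_same[OF assms(1), of B C "c B"] that
      by simp_all
    then show ?thesis by simp
  qed
  show "inj_on c T"
  proof (rule inj_onI)
    fix A B assume "A \<in> T" "B \<in> T" "c A = c B"
    then show "A = B" using same[of A B A] assms(2) assms(3)[of A] by auto
  qed
  show "partial_transversal P (c ` T)"
    unfolding partial_transversal_def
  proof (intro conjI ballI impI notI)
    show "c ` T \<subseteq> \<Union>P" using assms(2,3) by blast
    fix u v assume "u \<in> c ` T" "v \<in> c ` T" "u \<noteq> v" "\<exists>A\<in>P. u \<in> A \<and> v \<in> A"
    then obtain A B C where "A \<in> T" "B \<in> T" "C \<in> P" "u = c A" "v = c B" "c A \<in> C" "c B \<in> C"
      by blast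
    then show False using same[of A B C] \<open>u \<noteq> v\<close> by simp
  qed
qed

text \<open>
  Keeping the classes that \<open>K\<close> meets together with the choice function makes the representation unique, because
  \<open>c\<close> is \<open>undefined\<close> outside \<open>T\<close>; \<open>sum_partial_transversals\<close> counts with it.
\<close>

lemma partial_transversal_cases:
  assumes "partition_on W P" "partial_transversal P K"
  obtains T c where "T \<subseteq> P" "c \<in> PiE T (\<lambda>A. A)" "c ` T = K"
proof -
  define T where "T = {A \<in> P. A \<inter> K \<noteq> {}}"
  define c where "c = restrict (\<lambda>A. SOME v. v \<in> A \<inter> K) T"
  have c: "c A \<in> A \<inter> K" if "A \<in> T" for A
  proof -
    have "\<exists>v. v \<in> A \<inter> K" using that by (auto simp: T_def)
    then have "(SOME v. v \<in> A \<inter> K) \<in> A \<inter> K" by (rule someI_ex)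
    then show ?thesis using that by (simp add: c_def)
  qed
  have "c ` T = K"
  proof (intro equalityI subsetI)
    fix v assume v: "v \<in> K"
    have "K \<subseteq> \<Union>P" using assms(2) unfolding partial_transversal_def by (rule conjunct1)
    then obtain A where A: "A \<in> P" "v \<in> A" using v by blast
    then have "A \<in> T" using v unfolding T_def by blast
    moreover have "c A = v"
    proof (rule ccontr)
      assume "c A \<noteq> v"
      moreover have "c A \<in> A" "c A \<in> K" using c[OF \<open>A \<in> T\<close>] by simp_all
      moreover have "\<forall>u\<in>K. \<forall>v\<in>K. u \<noteq> v \<longrightarrow> \<not> (\<exists>A\<in>P. u \<in> A \<and> v \<in> A)"
        using assms(2) unfolding partial_transversal_def by (rule conjunct2)
      ultimately show False using A v by metis
    qed
    ultimately show "v \<in> c ` T" by (metis imageI)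
  next
    fix v assume "v \<in> c ` T"
    then obtain A where "A \<in> T" "v = c A" by (rule imageE)
    then show "v \<in> K" using c[of A] by simp
  qed
  moreover have "c \<in> PiE T (\<lambda>A. A)"
    using c by (intro PiE_I) (simp_all add: c_def)
  moreover have "T \<subseteq> P" by (auto simp: T_def)
  ultimately show ?thesis using that[of T c] by blast
qed

lemma card_partial_transversal_le:
  assumes "partition_on W P" "finite P" "partial_transversal P K"
  shows "card K \<le> card P"
proof -
  obtain T c where "T \<subseteq> P" "c ` T = K" using partial_transversal_cases[OF assms(1,3)] .
  moreover then have "finite T" using assms(2) finite_subset by auto
  ultimately show ?thesis using card_image_le[of T c] card_mono[OF assms(2), of T] by simp
qed

text \<open>
  Expanding the product of the class sums over \<open>T\<close> gives one term for each choice of a representative from every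
  class in \<open>T\<close>.
\<close>

lemma sum_partial_transversals:
  assumes "finite W" "partition_on W P"
  shows "(\<Sum>K | partial_transversal P K \<and> card K = t. \<Prod>v\<in>K. y v) = elem_sym t P (\<lambda>A. \<Sum>v\<in>A. y v)"
proof -
  define I where "I = Sigma {T. T \<subseteq> P \<and> card T = t} (\<lambda>T. PiE T (\<lambda>A. A))"
  have finP: "finite P" using assms by (rule finite_elements)
  have finA: "finite A" if "A \<in> P" for A
    using assms that by (metis Union_upper finite_subset partition_onD1)
  have finT: "finite T" if "T \<subseteq> P" for T using that finP by (rule finite_subset)
  have inj: "inj_on g T" "partial_transversal P (g ` T)" if "T \<subseteq> P" "g \<in> PiE T (\<lambda>A. A)" for T g
    using partial_transversal_choice[OF assms(2) that(1), of g] PiE_mem[OF that(2)] by simp_all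
  have bij: "bij_betw (\<lambda>(T, g). g ` T) I {K. partial_transversal P K \<and> card K = t}"
  proof (rule bij_betwI')
    fix p q assume pq: "p \<in> I" "q \<in> I"
    have sub: "T \<subseteq> T' \<and> (\<forall>A\<in>T. g A = g' A)"
      if "T \<subseteq> P" "T' \<subseteq> P" "g \<in> PiE T (\<lambda>A. A)" "g' \<in> PiE T' (\<lambda>A. A)" "g ` T = g' ` T'" for T T' g g'
    proof -
      have "A \<in> T' \<and> g A = g' A" if A: "A \<in> T" for A
      proof -
        have "g A \<in> g' ` T'" using A \<open>g ` T = g' ` T'\<close> by auto
        then obtain B where "B \<in> T'" "g A = g' B" by auto
        moreover then have "g A \<in> A" "g A \<in> B"
          using A \<open>g \<in> PiE T (\<lambda>A. A)\<close> \<open>g' \<in> PiE T' (\<lambda>A. A)\<close> by (auto simp: PiE_iff)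
        moreover have "A \<in> P" "B \<in> P" using A \<open>B \<in> T'\<close> \<open>T \<subseteq> P\<close> \<open>T' \<subseteq> P\<close> by auto
        ultimately show ?thesis using partition_on_same[OF assms(2)] by metis
      qed
      then show ?thesis by blast
    qed
    obtain T g T' g' where eq: "p = (T, g)" "q = (T', g')" by (cases p, cases q)
    show "(case p of (T, g) \<Rightarrow> g ` T) = (case q of (T, g) \<Rightarrow> g ` T) \<longleftrightarrow> p = q"
    proof
      assume "(case p of (T, g) \<Rightarrow> g ` T) = (case q of (T, g) \<Rightarrow> g ` T)"
      then have im: "g ` T = g' ` T'" by (simp add: eq)
      have g: "g \<in> PiE T (\<lambda>A. A)" "g' \<in> PiE T' (\<lambda>A. A)" and T: "T \<subseteq> P" "T' \<subseteq> P"
        using pq by (simp_all add: eq I_def)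
      have "T \<subseteq> T'" "T' \<subseteq> T" "\<forall>A\<in>T. g A = g' A"
        using sub[OF T g im] sub[OF T(2,1) g(2,1) im[symmetric]] by blast+
      with g have "T = T'" "g = g'" by (blast, metis PiE_ext subset_antisym)
      then show "p = q" by (simp add: eq)
    qed simp
  next
    fix p assume "p \<in> I"
    then show "(case p of (T, g) \<Rightarrow> g ` T) \<in> {K. partial_transversal P K \<and> card K = t}"
      using inj(1,2)[of "fst p" "snd p"] by (cases p) (simp add: I_def card_image)
  next
    fix K assume K: "K \<in> {K. partial_transversal P K \<and> card K = t}"
    then have "partial_transversal P K" by simp
    then obtain T c where T: "T \<subseteq> P" "c \<in> PiE T (\<lambda>A. A)" "c ` T = K"
      by (rule partial_transversal_cases[OF assms(2)])
    then have "card T = t" using K card_image[OF inj(1)[OF T(1,2)]] by simp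
    then have "(T, c) \<in> I" using T by (simp add: I_def)
    then show "\<exists>p\<in>I. K = (case p of (T, g) \<Rightarrow> g ` T)" using T by (intro bexI[of _ "(T, c)"]) auto
  qed
  have "elem_sym t P (\<lambda>A. \<Sum>v\<in>A. y v) = (\<Sum>T | T \<subseteq> P \<and> card T = t. \<Sum>g\<in>PiE T (\<lambda>A. A). \<Prod>A\<in>T. y (g A))"
    unfolding elem_sym_def
    by (intro sum.cong refl prod_sum_PiE) (use finT finA in blast)+
  also have "\<dots> = (\<Sum>(T, g)\<in>I. \<Prod>A\<in>T. y (g A))"
    unfolding I_def
    by (intro sum.Sigma ballI finite_PiE) (use finP finT finA in auto)
  also have "\<dots> = (\<Sum>(T, g)\<in>I. \<Prod>v\<in>g ` T. y v)"
    using inj(1) by (intro sum.cong refl) (auto simp: I_def prod.reindex o_def)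
  also have "\<dots> = (\<Sum>p\<in>I. \<Prod>v\<in>(case p of (T, g) \<Rightarrow> g ` T). y v)"
    by (simp add: case_prod_unfold)
  also have "\<dots> = (\<Sum>K | partial_transversal P K \<and> card K = t. \<Prod>v\<in>K. y v)"
    by (rule sum.reindex_bij_betw[OF bij])
  finally show ?thesis by simp
qed

text \<open>
  If the edges of \<open>t\<close>-cliques form a complete multipartite graph, its classes determine all larger cliques
  too: as \<open>t \<ge> 2\<close>, any two vertices of a clique with at least \<open>t\<close> vertices lie in a common \<open>t\<close>-clique, so such a clique is a
  partial transversal.  As each vertex lies in a transversal of all the classes, the number of classes is the clique number
  and also the size of the largest clique at every vertex.
\<close>

lemma complete_multipartite_cliques:
  assumes G: "pair_graph G" and t: "2 \<le> t" "t \<le> clique_number G" and "W \<subseteq> pverts G"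
    and P: "partition_on W P"
    and arcs: "parcs (delete_non_clique_edges G t) = {(u, v) \<in> W \<times> W. \<not> (\<exists>A\<in>P. u \<in> A \<and> v \<in> A)}"
  shows "cliques_of_size G t = {K. partial_transversal P K \<and> card K = t}"
    and "card P = clique_number G"
    and "\<And>v. v \<in> W \<Longrightarrow> vertex_clique_number G v = clique_number G"
proof -
  interpret pair_graph G by fact
  have finP: "finite P"
    using finite_elements[OF finite_subset[OF \<open>W \<subseteq> pverts G\<close> pair_finite_verts] P] .
  have W: "\<Union>P = W" using partition_onD1[OF P] by simp
  have cl: "clique G K" if K: "partial_transversal P K" for K
    unfolding clique_iff[OF G]
  proof (intro conjI ballI impI)
    have KW: "K \<subseteq> W"
      and K': "\<And>u v. u \<in> K \<Longrightarrow> v \<in> K \<Longrightarrow> u \<noteq> v \<Longrightarrow> \<not> (\<exists>A\<in>P. u \<in> A \<and> v \<in> A)"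
      using K unfolding partial_transversal_def W by blast+
    show "K \<subseteq> pverts G" using KW \<open>W \<subseteq> pverts G\<close> by (rule subset_trans)
    fix u v assume "u \<in> K" "v \<in> K" "u \<noteq> v"
    then have "(u, v) \<in> parcs (delete_non_clique_edges G t)"
      unfolding arcs using K'[of u v] KW by blast
    then show "(u, v) \<in> parcs G" by (auto simp: delete_non_clique_edges_def)
  qed
  have tr: "partial_transversal P K" if K: "clique G K" "t \<le> card K" for K
  proof -
    have finK: "finite K" using K t by (intro card_ge_0_finite) auto
    have arc: "(u, v) \<in> parcs (delete_non_clique_edges G t)" if uv: "u \<in> K" "v \<in> K" "u \<noteq> v" for u v
    proof -
      obtain L where L: "{u, v} \<subseteq> L" "L \<subseteq> K" "card L = t"
        using exists_subset_between[of "{u, v}" t K] uv K t finK by auto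
      have "L \<in> cliques_of_size G t"
        using clique_subset[OF G K(1) L(2)] L(3) by (simp add: cliques_of_size_def)
      moreover have "(u, v) \<in> parcs G"
        using K(1) uv unfolding clique_iff[OF G] by blast
      ultimately show ?thesis
        using L(1) by (auto simp: delete_non_clique_edges_def)
    qed
    have "u \<in> W" if "u \<in> K" for u
    proof -
      have "\<not> K \<subseteq> {u}" using card_mono[of "{u}" K] K t by auto
      then obtain v where "v \<in> K" "v \<noteq> u" by auto
      then have "(u, v) \<in> parcs (delete_non_clique_edges G t)" using arc that by simp
      then show ?thesis unfolding arcs by simp
    qed
    then have "K \<subseteq> \<Union>P" using W by auto
    moreover have "\<not> (\<exists>A\<in>P. u \<in> A \<and> v \<in> A)" if "u \<in> K" "v \<in> K" "u \<noteq> v" for u v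
      using arc[OF that] unfolding arcs by simp
    ultimately show ?thesis unfolding partial_transversal_def by blast
  qed
  show "cliques_of_size G t = {K. partial_transversal P K \<and> card K = t}"
  proof (rule set_eqI, rule iffI)
    fix K assume "K \<in> cliques_of_size G t"
    then show "K \<in> {K. partial_transversal P K \<and> card K = t}"
      using tr[of K] by (simp add: cliques_of_size_def)
  next
    fix K assume "K \<in> {K. partial_transversal P K \<and> card K = t}"
    then show "K \<in> cliques_of_size G t"
      using cl[of K] by (simp add: cliques_of_size_def)
  qed
  have full: "\<exists>K. partial_transversal P K \<and> card K = card P \<and> v \<in> K" if v: "v \<in> W" for v
  proof -
    obtain A where A: "A \<in> P" "v \<in> A" using v W by auto
    define c where "c B = (if v \<in> B then v else SOME u. u \<in> B)" for B
    have "c B \<in> B" if "B \<in> P" for B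
    proof -
      have "B \<noteq> {}" using that partition_onD3[OF P] by metis
      then have "\<exists>u. u \<in> B" by auto
      then have "(SOME u. u \<in> B) \<in> B" by (rule someI_ex)
      then show ?thesis by (simp add: c_def)
    qed
    then have "inj_on c P" "partial_transversal P (c ` P)"
      using partial_transversal_choice[OF P, of P c] by simp_all
    moreover have "v \<in> c ` P" using A by (intro image_eqI[of _ _ A]) (simp_all add: c_def)
    ultimately show ?thesis using card_image[of c P] by (intro exI[of _ "c ` P"]) simp
  qed
  obtain M where M: "clique G M" "card M = clique_number G" using clique_number_attained[OF G] .
  then have trM: "partial_transversal P M" using t by (intro tr) auto
  then have le: "clique_number G \<le> card P"
    using card_partial_transversal_le[OF P finP] M by metis
  have "M \<noteq> {}" using M t by auto
  then obtain a where "a \<in> W" using trM W unfolding partial_transversal_def by blast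
  then obtain K where "partial_transversal P K" "card K = card P" using full by blast
  then show eq: "card P = clique_number G"
    using card_le_clique_number[OF G cl] le by fastforce
  show "vertex_clique_number G v = clique_number G" if "v \<in> W" for v
  proof (rule antisym)
    show "vertex_clique_number G v \<le> clique_number G"
      using that \<open>W \<subseteq> pverts G\<close> by (intro vertex_clique_number_le[OF G]) auto
    show "clique_number G \<le> vertex_clique_number G v"
    proof -
      obtain K where "partial_transversal P K" "card K = card P" "v \<in> K" using full \<open>v \<in> W\<close> by blast
      then show ?thesis using card_le_vertex_clique_number[OF G cl, of K v] eq by simp
    qed
  qed
qed

lemma sum_over_partition:
  fixes f :: "'a \<Rightarrow> real"
  assumes "finite W" "partition_on W P"
  shows "(\<Sum>A\<in>P. \<Sum>v\<in>A. f v) = (\<Sum>v\<in>W. f v)"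
proof -
  have "(\<Sum>v\<in>\<Union>P. f v) = (\<Sum>A\<in>P. \<Sum>v\<in>A. f v)"
  proof (subst sum.Union_disjoint)
    show "\<forall>A\<in>P. finite A" using assms by (metis Union_upper finite_subset partition_onD1)
    show "\<forall>A\<in>P. \<forall>B\<in>P. A \<noteq> B \<longrightarrow> A \<inter> B = {}"
      using partition_onD2[OF assms(2)] by (metis disjointD)
  qed simp
  then show ?thesis using partition_onD1[OF assms(2)] by simp
qed

lemma pair_graph_multipartite:
  assumes "finite W" "partition_on W P"
  shows "pair_graph \<lparr>pverts = W, parcs = {(u, v) \<in> W \<times> W. \<not> (\<exists>A\<in>P. u \<in> A \<and> v \<in> A)}\<rparr>"
proof -
  define E where "E = {(u, v) \<in> W \<times> W. \<not> (\<exists>A\<in>P. u \<in> A \<and> v \<in> A)}"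
  have sub: "E \<subseteq> W \<times> W" by (auto simp: E_def)
  then have "finite E" using assms(1) by (simp add: finite_subset)
  have "sym E" unfolding E_def sym_def by blast
  have "W \<subseteq> \<Union>P" using partition_onD1[OF assms(2)] by simp
  then have irrefl: "(u, u) \<notin> E" for u unfolding E_def by blast
  have "pair_graph \<lparr>pverts = W, parcs = E\<rparr>"
  proof
    show "symmetric (with_proj \<lparr>pverts = W, parcs = E\<rparr>)" using \<open>sym E\<close> by (simp add: symmetric_def)
    show "fst e \<noteq> snd e" if "e \<in> parcs \<lparr>pverts = W, parcs = E\<rparr>" for e
      using that irrefl by (cases e) auto
  qed (use sub \<open>finite E\<close> assms(1) in auto)
  then show ?thesis unfolding E_def .
qed

section \<open>The spectral bound\<close>

locale clique_setting = pair_graph G for G :: "'a pair_pre_digraph" +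
  fixes t :: nat
  assumes t_ge_2: "2 \<le> t" and t_le: "t \<le> clique_number G"
begin

lemma graph: "pair_graph G" by unfold_locales

abbreviation "V \<equiv> pverts G"
abbreviation "C \<equiv> cliques_of_size G t"
abbreviation "\<rho> \<equiv> clique_spectral_radius G t"

definition vertex_weight :: "'a \<Rightarrow> real" where
  "vertex_weight v = root (t - 1) (clique_density t (vertex_clique_number G v))"

text \<open>
  The average over the clique, rather than the minimum or the maximum, is what makes the clique weights add up
  exactly to \<open>total_weight / t\<close>.
\<close>

definition clique_weight :: "'a set \<Rightarrow> real" where
  "clique_weight K = (\<Sum>v\<in>K. vertex_weight v) / real t"

definition coeff :: "'a set \<Rightarrow> real" where
  "coeff K = 1 / clique_weight K ^ (t - 1)"

definition total_weight :: real where
  "total_weight = (\<Sum>v\<in>V. real (vertex_clique_count G t v) * vertex_weight v)"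

lemma cliques_D: "K \<in> C \<Longrightarrow> K \<subseteq> V" "K \<in> C \<Longrightarrow> card K = t" "K \<in> C \<Longrightarrow> clique G K" "K \<in> C \<Longrightarrow> finite K"
  by (auto simp: cliques_of_size_def clique_def intro: rev_finite_subset[OF pair_finite_verts])

lemma finite_cliques_of_size: "finite C"
  using cliques_D(1) pair_finite_verts by (meson PowI finite_Pow_iff finite_subset subsetI)

lemma cliques_of_size_nonempty: "C \<noteq> {}"
proof -
  obtain K where "clique G K" "card K = clique_number G" using clique_number_attained[OF graph] .
  moreover then obtain L where "L \<subseteq> K" "card L = t" using obtain_subset_with_card_n[of t K] t_le by auto
  ultimately have "L \<in> C" using clique_subset[OF graph] by (auto simp: cliques_of_size_def)
  then show ?thesis by auto
qed

text \<open>
  A clique around \<open>K\<close> is counted by the local clique number of each vertex of \<open>K\<close>, so every term of the average is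
  large enough.
\<close>

lemma clique_weight_power_ge:
  assumes "K \<in> C" "clique G L" "K \<subseteq> L"
  shows "clique_density t (card L) \<le> clique_weight K ^ (t - 1)"
proof -
  let ?r = "root (t - 1) (clique_density t (card L))"
  have "?r \<le> vertex_weight v" if "v \<in> K" for v
    unfolding vertex_weight_def using t_ge_2 assms that
    by (intro real_root_le_mono clique_density_mono card_le_vertex_clique_number[OF graph]) auto
  then have "(\<Sum>v\<in>K. ?r) \<le> (\<Sum>v\<in>K. vertex_weight v)" by (rule sum_mono)
  then have "?r \<le> clique_weight K" using cliques_D(2)[OF assms(1)] t_ge_2 by (simp add: clique_weight_def field_simps)
  then have "?r ^ (t - 1) \<le> clique_weight K ^ (t - 1)"
    using t_ge_2 by (intro power_mono) (auto simp: clique_density_nonneg)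
  then show ?thesis using t_ge_2 by (simp add: clique_density_nonneg)
qed

lemma clique_weight_pos:
  assumes "K \<in> C"
  shows "0 < clique_weight K"
proof -
  have "0 < vertex_weight v" if "v \<in> K" for v
    unfolding vertex_weight_def using t_ge_2 card_le_vertex_clique_number[OF graph cliques_D(3)[OF assms] that] cliques_D(2)[OF assms]
    by (intro real_root_gt_zero clique_density_pos) auto
  then have "0 < (\<Sum>v\<in>K. vertex_weight v)" using cliques_D[OF assms] t_ge_2 by (intro sum_pos) auto
  then show ?thesis using t_ge_2 by (simp add: clique_weight_def)
qed

lemma coeff_pos: "K \<in> C \<Longrightarrow> 0 < coeff K"
  using clique_weight_pos by (simp add: coeff_def)

lemma sum_clique_weight: "(\<Sum>K\<in>C. clique_weight K) = total_weight / real t"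
proof -
  have "total_weight = (\<Sum>v\<in>V. \<Sum>K | K \<in> C \<and> v \<in> K. vertex_weight v)"
    by (simp add: total_weight_def vertex_clique_count_def)
  also have "\<dots> = (\<Sum>K\<in>C. \<Sum>v | v \<in> V \<and> v \<in> K. vertex_weight v)"
    using pair_finite_verts finite_cliques_of_size by (intro sum.swap_restrict) auto
  also have "\<dots> = (\<Sum>K\<in>C. \<Sum>v\<in>K. vertex_weight v)"
    using cliques_D(1) by (intro sum.cong refl) auto
  finally show ?thesis by (simp add: clique_weight_def sum_divide_distrib)
qed

lemma total_weight_pos: "0 < total_weight"
proof -
  have "0 < (\<Sum>K\<in>C. clique_weight K)" using finite_cliques_of_size cliques_of_size_nonempty clique_weight_pos by (intro sum_pos) auto
  then show ?thesis using sum_clique_weight t_ge_2 by (simp add: zero_less_divide_iff)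
qed

text \<open>
  By \<open>clique_weight_power_ge\<close> the coefficients meet the requirement of \<open>localised_Motzkin_Straus\<close>.
\<close>

lemma weighted_Motzkin_Straus:
  assumes "\<And>v. v \<in> V \<Longrightarrow> 0 \<le> y v"
  shows "set_poly C coeff {} y \<le> (\<Sum>v\<in>V. y v) ^ t"
proof (rule localised_Motzkin_Straus[where E = "\<lambda>u v. (u, v) \<in> parcs G"])
  show "K \<subseteq> V \<and> card K = t \<and> (\<forall>u\<in>K. \<forall>v\<in>K. u \<noteq> v \<longrightarrow> (u, v) \<in> parcs G)" if "K \<in> C" for K
    using cliques_D[OF that] clique_iff[OF graph, of K] by simp
  show "(v, u) \<in> parcs G" if "(u, v) \<in> parcs G" for u v
    using pair_sym_arcs that by (auto simp: symmetric_def sym_def)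
  show "coeff K \<le> 1 / clique_density t (card L)"
    if "K \<in> C" "K \<subseteq> L" "L \<subseteq> V" "\<forall>u\<in>L. \<forall>v\<in>L. u \<noteq> v \<longrightarrow> (u, v) \<in> parcs G" for K L
  proof -
    have L: "clique G L" using that clique_iff[OF graph, of L] by simp
    have "t \<le> card L"
      using cliques_D(2)[OF that(1)] card_mono[OF finite_subset[OF that(3) pair_finite_verts] that(2)] by simp
    then show ?thesis
      unfolding coeff_def using clique_weight_power_ge[OF that(1) L that(2)] clique_density_pos[of t "card L"] clique_weight_pos[OF that(1)]
      by (intro divide_left_mono mult_pos_pos) auto
  qed
  show "0 \<le> coeff K" if "K \<in> C" for K using coeff_pos[OF that] by simp
qed (use assms pair_finite_verts in auto)

lemma set_poly_coeff_power:
  "set_poly C coeff {} (\<lambda>v. x v ^ t) = (\<Sum>K\<in>C. (\<Prod>v\<in>K. x v) ^ t / clique_weight K ^ (t - 1))"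
  unfolding set_poly_empty coeff_def by (intro sum.cong refl) (simp add: prod_power_distrib)

text \<open>
  Radon's inequality, with the clique weights as weights, separates the weights from the vector.
\<close>

lemma edge_poly_power_le:
  assumes "\<And>v. v \<in> V \<Longrightarrow> 0 \<le> x v"
  shows "edge_poly C {} x ^ t \<le> set_poly C coeff {} (\<lambda>v. x v ^ t) * (total_weight / real t) ^ (t - 1)"
    and "edge_poly C {} x ^ t = set_poly C coeff {} (\<lambda>v. x v ^ t) * (total_weight / real t) ^ (t - 1) \<Longrightarrow> K \<in> C
      \<Longrightarrow> (\<Prod>v\<in>K. x v) = edge_poly C {} x / (total_weight / real t) * clique_weight K"
proof -
  have t: "Suc (t - 1) = t" "0 < t - 1" using t_ge_2 by auto
  have p: "0 \<le> (\<Prod>v\<in>K. x v)" if "K \<in> C" for K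
    using assms cliques_D(1)[OF that] by (intro prod_nonneg) auto
  have P: "edge_poly C {} x = (\<Sum>K\<in>C. \<Prod>v\<in>K. x v)" by (simp add: set_poly_empty)
  note R = Radon_ineq[where p = "\<lambda>K. \<Prod>v\<in>K. x v" and b = clique_weight and I = C and n = "t - 1", OF finite_cliques_of_size p clique_weight_pos,
      unfolded t(1)]
  show "edge_poly C {} x ^ t \<le> set_poly C coeff {} (\<lambda>v. x v ^ t) * (total_weight / real t) ^ (t - 1)"
    using R(1) unfolding set_poly_coeff_power P sum_clique_weight by simp
  show "(\<Prod>v\<in>K. x v) = edge_poly C {} x / (total_weight / real t) * clique_weight K"
    if "edge_poly C {} x ^ t = set_poly C coeff {} (\<lambda>v. x v ^ t) * (total_weight / real t) ^ (t - 1)" "K \<in> C"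
    using R(2)[OF _ _ t(2)] that unfolding set_poly_coeff_power P sum_clique_weight by simp
qed

lemma rhs_eq: "real t * total_weight ^ (t - 1) = real t ^ t * (total_weight / real t) ^ (t - 1)"
  using t_ge_2 by (cases t) (auto simp: power_divide)

lemma V_nonempty: "V \<noteq> {}"
proof -
  obtain K where "K \<in> C" using cliques_of_size_nonempty by auto
  then show ?thesis using cliques_D[of K] t_ge_2 by auto
qed

theorem spectral_bound: "\<rho> ^ t \<le> real t * total_weight ^ (t - 1)"
proof -
  obtain x where x: "\<And>v. 0 \<le> x v" "(\<Sum>v\<in>V. x v ^ t) = 1" and \<rho>: "\<rho> = real t * edge_poly C {} x"
    using clique_spectral_radius_variational[OF pair_finite_verts V_nonempty t_ge_2] by metis
  have "edge_poly C {} x ^ t \<le> set_poly C coeff {} (\<lambda>v. x v ^ t) * (total_weight / real t) ^ (t - 1)"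
    using x by (intro edge_poly_power_le) auto
  also have "\<dots> \<le> 1 * (total_weight / real t) ^ (t - 1)"
    using weighted_Motzkin_Straus[of "\<lambda>v. x v ^ t"] x total_weight_pos by (intro mult_right_mono) auto
  finally show ?thesis
    unfolding \<rho> rhs_eq power_mult_distrib by (intro mult_left_mono) auto
qed

section \<open>The extremal graphs\<close>

text \<open>
  Equality in the bound forces equality in both inequalities it is composed of.  Since the products over the cliques
  are then proportional to the positive clique weights, the vector is positive on every vertex of a clique.
\<close>

lemma extremal_vector:
  assumes x: "\<And>v. 0 \<le> x v" "(\<Sum>v\<in>V. x v ^ t) = 1" and \<rho>: "\<rho> = real t * edge_poly C {} x"
    and eq: "\<rho> ^ t = real t * total_weight ^ (t - 1)"
  shows "set_poly C coeff {} (\<lambda>v. x v ^ t) = 1"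
    and "K \<in> C \<Longrightarrow> (\<Prod>v\<in>K. x v) = edge_poly C {} x / (total_weight / real t) * clique_weight K"
    and "0 < edge_poly C {} x"
    and "v \<in> \<Union>C \<Longrightarrow> 0 < x v"
proof -
  let ?P = "edge_poly C {} x" and ?F = "set_poly C coeff {} (\<lambda>v. x v ^ t)" and ?B = "total_weight / real t"
  have B: "0 < ?B" using total_weight_pos t_ge_2 by simp
  have P: "?P ^ t = ?B ^ (t - 1)"
    using eq t_ge_2 unfolding \<rho> rhs_eq power_mult_distrib by simp
  have "?F \<le> 1" using weighted_Motzkin_Straus[of "\<lambda>v. x v ^ t"] x by simp
  moreover have "?B ^ (t - 1) \<le> ?F * ?B ^ (t - 1)" using edge_poly_power_le(1)[of x] x P by simp
  then have "1 \<le> ?F" using zero_less_power[OF B, of "t - 1"] by simp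
  ultimately show F: "?F = 1" by simp
  show prod: "(\<Prod>v\<in>K. x v) = ?P / ?B * clique_weight K" if "K \<in> C" for K
    using edge_poly_power_le(2)[of x K] x that P F by simp
  have "0 \<le> ?P" using x by (intro set_poly_nonneg) auto
  moreover have "?P \<noteq> 0" using P B t_ge_2 by (auto simp: power_0_left)
  ultimately show P0: "0 < ?P" by simp
  show "0 < x v" if v: "v \<in> \<Union>C"
  proof -
    obtain K where K: "K \<in> C" "v \<in> K" using v by auto
    have "0 < (\<Prod>v\<in>K. x v)" unfolding prod[OF K(1)] 
      using P0 B clique_weight_pos[OF K(1)] by (intro mult_pos_pos divide_pos_pos[OF P0])
    then have "x v \<noteq> 0" using K cliques_D(4)[OF K(1)] by (metis less_irrefl prod_zero)
    then show ?thesis using x(1)[of v] by simp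
  qed
qed

text \<open>
  The \<open>t\<close>-th powers of an extremal vector are a maximiser in the weighted Motzkin--Straus inequality, so
  \<open>maximiser_cooccurrence\<close> makes ``equal or in no common clique'' an equivalence relation; its classes are the
  parts.
\<close>

lemma extremal_multipartite:
  assumes x: "\<And>v. 0 \<le> x v" "(\<Sum>v\<in>V. x v ^ t) = 1" and \<rho>: "\<rho> = real t * edge_poly C {} x"
    and eq: "\<rho> ^ t = real t * total_weight ^ (t - 1)"
  obtains P where "partition_on (\<Union>C) P"
    "parcs (delete_non_clique_edges G t) = {(u, v) \<in> \<Union>C \<times> \<Union>C. \<not> (\<exists>A\<in>P. u \<in> A \<and> v \<in> A)}"
proof -
  note ext = extremal_vector[OF x \<rho> eq]
  let ?W = "\<Union>C"
  define co where "co u v \<longleftrightarrow> (\<exists>K\<in>C. {u, v} \<subseteq> K)" for u v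
  have co_sym: "co u v \<Longrightarrow> co v u" for u v by (auto simp: co_def)
  have co_trans: "co v z" if "co u z" "u \<noteq> z" "\<not> co u v" "v \<noteq> u" "v \<noteq> z" "v \<in> ?W" for u v z
  proof -
    obtain K where K: "K \<in> C" "u \<in> K" "z \<in> K" using \<open>co u z\<close> unfolding co_def by blast
    show ?thesis
      unfolding co_def
    proof (rule maximiser_cooccurrence[of V C coeff t "\<lambda>v. x v ^ t" K u z v])
      show "0 < x v ^ t" if "v \<in> ?W" for v using ext(4)[OF that] by simp
    qed (use K that x ext(1) coeff_pos weighted_Motzkin_Straus cliques_D(1) finite_cliques_of_size pair_finite_verts in \<open>auto simp: co_def\<close>)
  qed
  define r where "r = {(u, v) \<in> ?W \<times> ?W. u = v \<or> \<not> co u v}"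
  have r: "equiv ?W r"
  proof (rule equivI)
    show "refl_on ?W r" by (auto simp: refl_on_def r_def)
    show "sym r" using co_sym by (auto simp: sym_def r_def)
    show "trans r"
    proof (rule transI)
      fix u v z assume "(u, v) \<in> r" "(v, z) \<in> r"
      then show "(u, z) \<in> r" using co_trans[of u z v] co_sym[of v z] unfolding r_def by blast
    qed
  qed (auto simp: r_def)
  have same: "(\<exists>A\<in>?W // r. u \<in> A \<and> v \<in> A) \<longleftrightarrow> (u, v) \<in> r" if "u \<in> ?W" "v \<in> ?W" for u v
  proof
    assume "\<exists>A\<in>?W // r. u \<in> A \<and> v \<in> A"
    then show "(u, v) \<in> r" using in_quotient_imp_in_rel[OF r] by blast
  next
    assume "(u, v) \<in> r"
    moreover have "(u, u) \<in> r" using that by (auto simp: r_def)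
    moreover have "r `` {u} \<in> ?W // r" using that(1) by (rule quotientI)
    ultimately have "u \<in> r `` {u}" "v \<in> r `` {u}" "r `` {u} \<in> ?W // r" by blast+
    then show "\<exists>A\<in>?W // r. u \<in> A \<and> v \<in> A" by blast
  qed
  show ?thesis
  proof
    show "partition_on ?W (?W // r)" using r by (rule partition_on_quotient)
    have "(u, v) \<in> parcs G" if "co u v" "u \<noteq> v" for u v
      using that cliques_D(3) clique_iff[OF graph] by (auto simp: co_def)
    then have "parcs (delete_non_clique_edges G t) = {(u, v) \<in> ?W \<times> ?W. u \<noteq> v \<and> co u v}"
      using pair_no_loops by (fastforce simp: delete_non_clique_edges_def co_def)
    also have "\<dots> = {(u, v) \<in> ?W \<times> ?W. \<not> (\<exists>A\<in>?W // r. u \<in> A \<and> v \<in> A)}"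
      using same by (auto simp: r_def)
    finally show "parcs (delete_non_clique_edges G t)
      = {(u, v) \<in> ?W \<times> ?W. \<not> (\<exists>A\<in>?W // r. u \<in> A \<and> v \<in> A)}" .
  qed
qed

text \<open>
  All clique weights agree, so the extremal vector has the same product over every clique.  With more than \<open>t\<close> classes, any
  two vertices \<open>u\<close> and \<open>v\<close> extend one and the same transversal of \<open>t - 1\<close> further classes to a clique; comparing the two
  products shows that the vector is constant.  The class sums of its \<open>t\<close>-th powers attain equality in Maclaurin's inequality, so they agree, and with
  them the sizes of the classes.
\<close>

lemma extremal_regular:
  assumes x: "\<And>v. 0 \<le> x v" "(\<Sum>v\<in>V. x v ^ t) = 1" and \<rho>: "\<rho> = real t * edge_poly C {} x"
    and eq: "\<rho> ^ t = real t * total_weight ^ (t - 1)"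
    and W: "W \<subseteq> V" "\<Union>C \<subseteq> W" and P: "partition_on W P"
    and arcs: "parcs (delete_non_clique_edges G t) = {(u, v) \<in> W \<times> W. \<not> (\<exists>A\<in>P. u \<in> A \<and> v \<in> A)}"
    and gt: "t < clique_number G"
  shows "\<forall>A\<in>P. \<forall>B\<in>P. card A = card B"
proof -
  note ext = extremal_vector[OF x \<rho> eq]
  note mult = complete_multipartite_cliques[OF graph t_ge_2 t_le W(1) P arcs]
  define k where "k = clique_number G"
  define d where "d = clique_density t k"
  have finW: "finite W" using finite_subset[OF W(1) pair_finite_verts] .
  have finP: "finite P" using finite_elements[OF finW P] .
  have UP: "\<Union>P = W" using partition_onD1[OF P] by simp
  have k: "card P = k" "t < k" using mult(2) gt by (simp_all add: k_def)
  have hW: "vertex_weight v = root (t - 1) d" if "v \<in> W" for v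
    using mult(3)[OF that] by (simp add: vertex_weight_def d_def k_def)
  have bC: "clique_weight K = root (t - 1) d" if "K \<in> C" for K
  proof -
    have "(\<Sum>v\<in>K. vertex_weight v) = (\<Sum>v\<in>K. root (t - 1) d)"
      using hW W(2) that by (intro sum.cong) auto
    then show ?thesis using cliques_D(2)[OF that] t_ge_2 by (simp add: clique_weight_def)
  qed
  have d: "0 < d" using k unfolding d_def by (intro clique_density_pos) simp
  define m where "m = edge_poly C {} x / (total_weight / real t) * root (t - 1) d"
  have prod_m: "(\<Prod>v\<in>K. x v) = m" if "K \<in> C" for K
    using ext(2)[OF that] bC[OF that] by (simp add: m_def)
  have m: "0 < m"
    unfolding m_def using ext(3) total_weight_pos t_ge_2 d by (intro mult_pos_pos divide_pos_pos real_root_gt_zero) auto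
  have nonempty: "\<exists>v. v \<in> A" if "A \<in> P" for A
  proof -
    have "A \<noteq> {}" using that partition_onD3[OF P] by metis
    then show ?thesis by auto
  qed
  define c where "c A = (SOME v. v \<in> A)" for A :: "'a set"
  have c: "c A \<in> A" if "A \<in> P" for A
    using someI_ex[OF nonempty[OF that]] by (simp add: c_def)
  have const: "x u = x v" if uv: "u \<in> W" "v \<in> W" for u v
  proof -
    \<comment> \<open>\<open>A\<close> and \<open>B\<close> may coincide; in either case at least \<open>t - 1\<close> classes remain\<close>
    obtain A B where AB: "A \<in> P" "u \<in> A" "B \<in> P" "v \<in> B" using uv UP by blast
    have "t - 1 \<le> card (P - {A, B})"
    proof -
      have "card P - card {A, B} \<le> card (P - {A, B})" by (rule diff_card_le_card_Diff) simp
      moreover have "card {A, B} \<le> 2" by (simp add: card_insert_if)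
      ultimately show ?thesis using k by linarith
    qed
    then obtain T where T: "T \<subseteq> P - {A, B}" "card T = t - 1" "finite T"
      by (rule obtain_subset_with_card_n)
    have swap: "x z * (\<Prod>a\<in>c ` T. x a) = m" if z: "D \<in> P" "z \<in> D" "D \<notin> T" for D z
    proof -
      define c' where "c' = c(D := z)"
      have c'T: "c' ` insert D T = insert z (c ` T)"
      proof -
        have "c' ` T = c ` T" using z(3) by (intro image_cong) (auto simp: c'_def)
        moreover have "c' D = z" by (simp add: c'_def)
        ultimately show ?thesis by (metis image_insert)
      qed
      have sub: "insert D T \<subseteq> P" using T(1) z by auto
      have in_part: "c' E \<in> E" if "E \<in> insert D T" for E
        using c z sub that by (cases "E = D") (auto simp: c'_def)
      have inj: "inj_on c' (insert D T)" "partial_transversal P (c' ` insert D T)"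
        using partial_transversal_choice[OF P sub, of c'] in_part by blast+
      have "card (c' ` insert D T) = t"
        using card_image[OF inj(1)] T z t_ge_2 by simp
      then have K: "insert z (c ` T) \<in> C" using inj(2) mult(1) unfolding c'T by simp
      have "z \<notin> c ` T"
      proof
        assume "z \<in> c ` T"
        then obtain E where "E \<in> T" "z = c E" by auto
        then have "c' E = c' D" using z(3) by (auto simp: c'_def)
        then have "E = D" using inj_onD[OF inj(1)] \<open>E \<in> T\<close> by blast
        then show False using z(3) \<open>E \<in> T\<close> by simp
      qed
      then show ?thesis using prod_m[OF K] T(3) by simp
    qed
    have "A \<notin> T" "B \<notin> T" using T(1) by blast+
    then have "x u * (\<Prod>a\<in>c ` T. x a) = m" "x v * (\<Prod>a\<in>c ` T. x a) = m"
      using swap AB by blast+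
    then show ?thesis using m by (metis less_irrefl mult_cancel_right mult_zero_right)
  qed
  obtain a where a: "a \<in> W" using cliques_of_size_nonempty cliques_D(2) W(2) t_ge_2 by fastforce
  define y where "y v = x v ^ t" for v
  have ya: "0 < y a"
  proof -
    obtain K where K: "K \<in> C" using cliques_of_size_nonempty by auto
    moreover then obtain v where "v \<in> K" using cliques_D(2)[OF K] t_ge_2 by fastforce
    ultimately have "v \<in> \<Union>C" by blast
    then show ?thesis using ext(4)[of v] const[OF a, of v] W(2) by (auto simp: y_def)
  qed
  define z where "z A = (\<Sum>v\<in>A. y v)" for A
  have z: "z A = real (card A) * y a" if "A \<in> P" for A
  proof -
    have "z A = (\<Sum>v\<in>A. y a)"
      unfolding z_def y_def using const[OF _ a] UP that by (intro sum.cong refl arg_cong[of _ _ "\<lambda>s. s ^ t"]) auto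
    then show ?thesis by simp
  qed
  have z0: "0 \<le> z A" for A unfolding z_def y_def using x by (intro sum_nonneg) auto
  have "elem_sym t P z = (\<Sum>K\<in>C. \<Prod>v\<in>K. y v)"
    unfolding z_def mult(1) by (rule sum_partial_transversals[OF finW P, symmetric])
  also have "\<dots> = (\<Sum>K\<in>C. d * (coeff K * (\<Prod>v\<in>K. y v)))"
  proof (intro sum.cong refl)
    fix K assume "K \<in> C"
    then have "coeff K = 1 / d" using bC d t_ge_2 by (simp add: coeff_def)
    then show "(\<Prod>v\<in>K. y v) = d * (coeff K * (\<Prod>v\<in>K. y v))" using d by simp
  qed
  also have "\<dots> = d * set_poly C coeff {} y" by (simp add: set_poly_empty sum_distrib_left)
  also have "set_poly C coeff {} y = 1" using ext(1) by (simp add: y_def[abs_def])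
  finally have e: "elem_sym t P z = d" by simp
  have "(\<Sum>A\<in>P. z A) = (\<Sum>v\<in>W. y v)" unfolding z_def by (rule sum_over_partition[OF finW P])
  also have "\<dots> \<le> (\<Sum>v\<in>V. y v)" using W x by (intro sum_mono2) (auto simp: y_def pair_finite_verts)
  also have "\<dots> = 1" using x(2) by (simp add: y_def)
  finally have "(\<Sum>A\<in>P. z A) \<le> 1" .
  then have "(\<Sum>A\<in>P. z A) ^ t \<le> 1" using z0 by (intro power_le_one sum_nonneg)
  then have "d * (\<Sum>A\<in>P. z A) ^ t \<le> d * 1" using d by (intro mult_left_mono) auto
  moreover have mean: "real (card P choose t) * ((\<Sum>A\<in>P. z A) / real (card P)) ^ t = d * (\<Sum>A\<in>P. z A) ^ t"
    by (simp add: d_def clique_density_def k(1) power_divide)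
  moreover have "elem_sym t P z \<le> real (card P choose t) * ((\<Sum>A\<in>P. z A) / real (card P)) ^ t"
    using finP z0 by (rule Maclaurin_ineq)
  ultimately have eqM: "elem_sym t P z = real (card P choose t) * ((\<Sum>A\<in>P. z A) / real (card P)) ^ t"
    using e by linarith
  have zc: "z A = (\<Sum>A\<in>P. z A) / real (card P)" if "A \<in> P" for A
    using k t_ge_2 that by (intro Maclaurin_eqD[OF finP z0 t_ge_2 _ eqM]) auto
  show ?thesis
  proof (intro ballI)
    fix A B assume AB: "A \<in> P" "B \<in> P"
    have "real (card A) * y a = real (card B) * y a"
      unfolding z[OF AB(1), symmetric] z[OF AB(2), symmetric] zc[OF AB(1)] zc[OF AB(2)] ..
    then show "card A = card B" using ya by simp
  qed
qed

text \<open>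
  A vector whose \<open>t\<close>-th powers are constant on each class and have the same sum over every class attains equality in the
  weighted Motzkin--Straus inequality.  For equality in Radon's inequality the products over the cliques have to agree
  as well.  They do if there are only \<open>t\<close> classes, because every clique then meets all of them, and they do if the classes
  have equal size, because then the vector is constant.
\<close>

lemma multipartite_extremal:
  assumes W: "W \<subseteq> V" and P: "partition_on W P"
    and arcs: "parcs (delete_non_clique_edges G t) = {(u, v) \<in> W \<times> W. \<not> (\<exists>A\<in>P. u \<in> A \<and> v \<in> A)}"
    and shape: "clique_number G = t \<or> (\<forall>A\<in>P. \<forall>B\<in>P. card A = card B)"
  shows "real t * total_weight ^ (t - 1) \<le> \<rho> ^ t"
proof -
  note mult = complete_multipartite_cliques[OF graph t_ge_2 t_le W P arcs]
  define k where "k = clique_number G"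
  define d where "d = clique_density t k"
  have finW: "finite W" using finite_subset[OF W pair_finite_verts] .
  have finP: "finite P" using finite_elements[OF finW P] .
  have UP: "\<Union>P = W" using partition_onD1[OF P] by simp
  have k: "card P = k" "t \<le> k" using mult(2) t_le by (simp_all add: k_def)
  have d: "0 < d" using k unfolding d_def by (intro clique_density_pos) simp
  have CW: "K \<subseteq> W" if "K \<in> C" for K
    using that UP unfolding mult(1) partial_transversal_def by simp
  have bC: "clique_weight K = root (t - 1) d" if "K \<in> C" for K
  proof -
    have "(\<Sum>v\<in>K. vertex_weight v) = (\<Sum>v\<in>K. root (t - 1) d)"
      using mult(3) CW[OF that] by (intro sum.cong) (auto simp: vertex_weight_def d_def k_def)
    then show ?thesis using cliques_D(2)[OF that] t_ge_2 by (simp add: clique_weight_def)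
  qed
  define cls where "cls v = (SOME A. A \<in> P \<and> v \<in> A)" for v
  have cls: "cls v = A" if "A \<in> P" "v \<in> A" for v A
  proof -
    have "\<exists>A. A \<in> P \<and> v \<in> A" using that by blast
    then have "cls v \<in> P \<and> v \<in> cls v" unfolding cls_def by (rule someI_ex)
    then show ?thesis using partition_on_same[OF P _ that(1) _ that(2)] by blast
  qed
  \<comment> \<open>each class receives the total mass \<open>1 / k\<close>, spread evenly\<close>
  define y where "y v = (if v \<in> W then 1 / (real k * real (card (cls v))) else 0)" for v
  have y: "y v = 1 / (real k * real (card A))" if "A \<in> P" "v \<in> A" for v A
    using cls[OF that] UP that by (auto simp: y_def)
  have y0: "0 \<le> y v" for v by (simp add: y_def)
  have cardA: "0 < card A" if "A \<in> P" for A
  proof -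
    have "A \<noteq> {}" using that partition_onD3[OF P] by metis
    moreover have "A \<subseteq> W" using UP that by auto
    ultimately show ?thesis using finite_subset[OF _ finW] card_gt_0_iff by blast
  qed
  have class_sum: "(\<Sum>v\<in>A. y v) = 1 / real k" if "A \<in> P" for A
  proof -
    have "(\<Sum>v\<in>A. y v) = (\<Sum>v\<in>A. 1 / (real k * real (card A)))"
      using y[OF that] by (intro sum.cong) auto
    then show ?thesis using cardA[OF that] by simp
  qed
  have "(\<Sum>v\<in>V. y v) = (\<Sum>v\<in>W. y v)"
    using W pair_finite_verts by (intro sum.mono_neutral_right) (auto simp: y_def)
  also have "\<dots> = (\<Sum>A\<in>P. \<Sum>v\<in>A. y v)" by (rule sum_over_partition[OF finW P, symmetric])
  also have "\<dots> = 1" using class_sum k t_ge_2 by simp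
  finally have sum_y: "(\<Sum>v\<in>V. y v) = 1" .
  have "(\<Sum>K\<in>C. \<Prod>v\<in>K. y v) = elem_sym t P (\<lambda>A. \<Sum>v\<in>A. y v)"
    unfolding mult(1) by (rule sum_partial_transversals[OF finW P])
  also have "\<dots> = (\<Sum>T | T \<subseteq> P \<and> card T = t. (1 / real k) ^ t)"
    unfolding elem_sym_def
  proof (intro sum.cong refl)
    fix T assume "T \<in> {T. T \<subseteq> P \<and> card T = t}"
    then have T: "T \<subseteq> P" "card T = t" by auto
    have "(\<Prod>A\<in>T. \<Sum>v\<in>A. y v) = (\<Prod>A\<in>T. 1 / real k)"
      using T class_sum by (intro prod.cong) auto
    then show "(\<Prod>A\<in>T. \<Sum>v\<in>A. y v) = (1 / real k) ^ t" using T by simp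
  qed
  also have "\<dots> = d" using n_subsets[OF finP, of t] by (simp add: d_def clique_density_def k(1) power_divide)
  finally have sum_prod: "(\<Sum>K\<in>C. \<Prod>v\<in>K. y v) = d" .
  have "\<exists>q. \<forall>K\<in>C. (\<Prod>v\<in>K. y v) = q"
  proof (cases "clique_number G = t")
    case True
    have "(\<Prod>v\<in>K. y v) = (\<Prod>A\<in>P. 1 / (real k * real (card A)))" if "K \<in> C" for K
    proof -
      have "partial_transversal P K" "card K = t" using that unfolding mult(1) by simp_all
      then obtain T c where T: "T \<subseteq> P" "c \<in> PiE T (\<lambda>A. A)" "c ` T = K"
        using partial_transversal_cases[OF P] by metis
      have cA: "c A \<in> A" if "A \<in> T" for A using PiE_mem[OF T(2) that] .
      have inj: "inj_on c T" using partial_transversal_choice(1)[OF P T(1)] cA by blast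
      then have "card T = card P" using card_image[OF inj] T(3) \<open>card K = t\<close> True k(1) by (simp add: k_def)
      then have "T = P" using T(1) finP by (simp add: card_subset_eq)
      have "(\<Prod>v\<in>K. y v) = (\<Prod>A\<in>T. y (c A))"
        unfolding T(3)[symmetric] using prod.reindex[OF inj, of y] by simp
      also have "\<dots> = (\<Prod>A\<in>T. 1 / (real k * real (card A)))"
        using T(1) cA y by (intro prod.cong) auto
      finally show ?thesis using \<open>T = P\<close> by simp
    qed
    then show ?thesis by blast
  next
    case False
    then have reg: "\<forall>A\<in>P. \<forall>B\<in>P. card A = card B" using shape by blast
    have "P \<noteq> {}" using k t_ge_2 by auto
    then obtain B where B: "B \<in> P" by auto
    have "(\<Prod>v\<in>K. y v) = (1 / (real k * real (card B))) ^ t" if "K \<in> C" for K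
    proof -
      have "y v = 1 / (real k * real (card B))" if "v \<in> K" for v
      proof -
        obtain A where "A \<in> P" "v \<in> A" using CW[OF \<open>K \<in> C\<close>] \<open>v \<in> K\<close> UP by blast
        then show ?thesis using y reg B by metis
      qed
      then have "(\<Prod>v\<in>K. y v) = (\<Prod>v\<in>K. 1 / (real k * real (card B)))" by (intro prod.cong) auto
      then show ?thesis using cliques_D(2)[OF that] by simp
    qed
    then show ?thesis by blast
  qed
  then obtain q where q: "(\<Prod>v\<in>K. y v) = q" if "K \<in> C" for K by blast
  define N where "N = real (card C)"
  have Nq: "N * q = d" using sum_prod q by (simp add: N_def)
  have q0: "0 \<le> q" using q cliques_of_size_nonempty y0 by (metis all_not_in_conv prod_nonneg)
  define x where "x v = root t (y v)" for v
  have x: "0 \<le> x v" "x v ^ t = y v" for v using y0[of v] t_ge_2 by (simp_all add: x_def)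
  have prod_x: "(\<Prod>v\<in>K. x v) = root t q" if "K \<in> C" for K
  proof -
    have "(\<Prod>v\<in>K. x v) ^ t = q"
      using q[OF that] x(2) by (simp add: prod_power_distrib)
    then show ?thesis using x(1) t_ge_2 by (metis prod_nonneg real_root_power_cancel zero_less_numeral
      less_le_trans)
  qed
  have P_x: "edge_poly C {} x = N * root t q" using prod_x by (simp add: set_poly_empty N_def)
  have "real t * edge_poly C {} x \<le> \<rho>"
  proof -
    have "real t * edge_poly C {} x \<le> \<rho> * (\<Sum>v\<in>V. x v ^ t)"
      using clique_spectral_radius_variational[OF pair_finite_verts V_nonempty t_ge_2] x(1) by metis
    then show ?thesis using x(2) sum_y by simp
  qed
  then have "(real t * (N * root t q)) ^ t \<le> \<rho> ^ t"
    unfolding P_x using q0 by (intro power_mono mult_nonneg_nonneg real_root_ge_zero) (auto simp: N_def)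
  moreover have "(real t * (N * root t q)) ^ t = real t * total_weight ^ (t - 1)"
  proof -
    obtain n where n: "t = Suc n" "0 < n" using t_ge_2 by (cases t) auto
    have "total_weight / real t = N * root (t - 1) d"
      unfolding sum_clique_weight[symmetric] using bC by (simp add: N_def)
    then have "real t * total_weight ^ (t - 1) = real t ^ t * (N ^ (t - 1) * d)"
      unfolding rhs_eq using d n by (simp add: power_mult_distrib)
    also have "\<dots> = real t ^ t * (N ^ t * q)" unfolding Nq[symmetric] using n by simp
    also have "\<dots> = (real t * (N * root t q)) ^ t"
      using q0 n by (simp add: power_mult_distrib del: power_Suc)
    finally show ?thesis by simp
  qed
  ultimately show ?thesis by simp
qed

end

theorem corollary3p3:
  fixes G :: "'a pair_pre_digraph" and t :: nat
  assumes "pair_graph G"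
    and "2 \<le> t" and "t \<le> clique_number G"
  shows "let \<omega> = clique_number G;
             H = delete_non_clique_edges G t;
             lhs = clique_spectral_radius G t ^ t;
             rhs = real t * (\<Sum>v\<in>pverts G. real (vertex_clique_count G t v) *
                     root (t - 1) (real (vertex_clique_number G v choose t)
                                     / real (vertex_clique_number G v) ^ t)) ^ (t - 1)
         in lhs \<le> rhs \<and>
            (lhs = rhs \<longleftrightarrow>
               (\<omega> = t \<and> up_to_isolated_vertices (complete_multipartite \<omega>) H) \<or>
               (\<omega> \<ge> t + 1 \<and> up_to_isolated_vertices (complete_regular_multipartite \<omega>) H))"
proof -
  interpret clique_setting G t
    using assms by (simp add: clique_setting_def clique_setting_axioms_def)
  let ?\<omega> = "clique_number G" and ?H = "delete_non_clique_edges G t"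
  let ?Hon = "\<lambda>W. \<lparr>pverts = W, parcs = parcs ?H\<rparr>"
  have rhs: "(\<Sum>v\<in>pverts G. real (vertex_clique_count G t v) *
      root (t - 1) (real (vertex_clique_number G v choose t) / real (vertex_clique_number G v) ^ t)) = total_weight"
    by (simp add: total_weight_def vertex_weight_def clique_density_def)
  have verts_H: "pverts ?H = V" by (simp add: delete_non_clique_edges_def)
  have multi: "complete_multipartite_with P (?Hon W) \<longleftrightarrow> partition_on W P
      \<and> parcs ?H = {(u, v) \<in> W \<times> W. \<not> (\<exists>A\<in>P. u \<in> A \<and> v \<in> A)}" if "W \<subseteq> V" for W P
  proof -
    have "finite W" using that pair_finite_verts by (rule finite_subset)
    then show ?thesis
      unfolding complete_multipartite_with_def using pair_graph_multipartite[of W P] by auto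
  qed
  have "(\<rho> ^ t = real t * total_weight ^ (t - 1)) \<longleftrightarrow>
      (?\<omega> = t \<and> up_to_isolated_vertices (complete_multipartite ?\<omega>) ?H) \<or>
      (?\<omega> \<ge> t + 1 \<and> up_to_isolated_vertices (complete_regular_multipartite ?\<omega>) ?H)" (is "?eq \<longleftrightarrow> ?shape")
  proof
    assume ?eq
    obtain x where x: "\<And>v. 0 \<le> x v" "(\<Sum>v\<in>V. x v ^ t) = 1" "\<rho> = real t * edge_poly C {} x"
      using clique_spectral_radius_variational[OF pair_finite_verts V_nonempty t_ge_2] by metis
    obtain P where P: "partition_on (\<Union>C) P"
      "parcs ?H = {(u, v) \<in> \<Union>C \<times> \<Union>C. \<not> (\<exists>A\<in>P. u \<in> A \<and> v \<in> A)}"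
      using extremal_multipartite[OF x \<open>?eq\<close>] .
    have W: "\<Union>C \<subseteq> V" using cliques_D(1) by blast
    have card: "card P = ?\<omega>" by (rule complete_multipartite_cliques(2)[OF graph t_ge_2 t_le W P])
    have sub: "\<Union>C \<subseteq> pverts ?H" "parcs ?H \<subseteq> \<Union>C \<times> \<Union>C" using W verts_H P(2) by auto
    have mp: "complete_multipartite_with P (?Hon (\<Union>C))" using multi[OF W] P by simp
    show ?shape
    proof (cases "?\<omega> = t")
      case True
      have "complete_multipartite ?\<omega> (?Hon (\<Union>C))"
        unfolding complete_multipartite_def using card mp by blast
      then show ?thesis using True sub unfolding up_to_isolated_vertices_def by blast
    next
      case False
      then have gt: "t < ?\<omega>" using t_le by simp
      have "\<forall>A\<in>P. \<forall>B\<in>P. card A = card B"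
        by (rule extremal_regular[OF x \<open>?eq\<close> W order_refl P gt])
      then have "complete_regular_multipartite ?\<omega> (?Hon (\<Union>C))"
        unfolding complete_regular_multipartite_def using card mp by blast
      moreover have "t + 1 \<le> ?\<omega>" using gt by simp
      ultimately show ?thesis using sub unfolding up_to_isolated_vertices_def by blast
    qed
  next
    assume ?shape
    then obtain W P where "W \<subseteq> V" "complete_multipartite_with P (?Hon W)"
      "?\<omega> = t \<or> (\<forall>A\<in>P. \<forall>B\<in>P. card A = card B)"
      unfolding up_to_isolated_vertices_def complete_multipartite_def complete_regular_multipartite_def verts_H
      by blast
    then have "real t * total_weight ^ (t - 1) \<le> \<rho> ^ t"
      using multi by (intro multipartite_extremal[of W P]) auto
    then show ?eq using spectral_bound by simp
  qed
  then show ?thesis unfolding Let_def rhs using spectral_bound by blast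
qed

end
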